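(* Let $(h,\ast,1)$ be a connected commutative presheaf and let $\mathcal I(h)\subseteq\mathcal G(h)$ be the set of irreducible coinvariants. Then $\mathcal A(h)$ is a free commutative algebra, and $\{\mathrm{p}_\iota:\iota\in\mathcal I(h)\}$ is a set of free generators of $\mathcal A(h)$.
   Context: A combinatorial presheaf $h$ is a contravariant functor from finite sets with injections to finite sets; $h[I]$ are objects on $I$, $a|_J$ restriction. $a\sim b$ if related by a relabeling bijection; $\mathcal G(h)=\biguplus_n h[[n]]/\sim$. For $b\in h[I]$, $\mathrm{p}_a(b)=|\{J'\subseteq I:b|_{J'}\sim a\}|$; $\mathcal A(h)$ is the $\mathbb Q$-span of $\{\mathrm{p}_a:a\in\mathcal G(h)\}$, an algebra under pointwise multiplication of functions $\mathcal G(h)\to\mathbb Q$. An associative presheaf $(h,\ast,1)$ has products $h[I]\times h[J]\to h[I\sqcup J]$ for disjoint $I,J$, natural in relabelings, with $(a\ast b)|_{A\sqcup B}=a|_A\ast b|_B$, associative, with unit $1\in h[\emptyset]$; it is commutative if $a\ast b=b\ast a$ for all $a,b$ on disjoint sets, and connected if $|h[\emptyset]|=1$. The induced product $\cdot$ on $\mathcal G(h)$ is the class of $a\ast b'$ with $b'$ a copy of $b$ on a set disjoint from that of $a$. A coinvariant $t\ne1$ is irreducible if $t=a\cdot b$ implies $a=1$ or $b=1$. *)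

theory Defs
  imports "HOL-Algebra.Algebra"
begin

subsection \<open>Free commutative algebras\<close>

definition rat_field :: "rat ring" where
  "rat_field = \<lparr>carrier = UNIV, monoid.mult = (*), one = 1, ring.zero = 0, ring.add = (+)\<rparr>"

definition monom_eval :: "('r, 'a, 'm) module_scheme \<Rightarrow> 'a multiset \<Rightarrow> 'a" where
  "monom_eval M m = (\<Otimes>\<^bsub>M\<^esub>x \<in> set_mset m. x [^]\<^bsub>M\<^esub> count m x)"

text \<open>The canonical map, substituting for variables, from polynomials whose variables are elements
  of \<open>M\<close> to \<open>M\<close>.
  As in the library, a polynomial sends each monomial, a multiset of variables, to its
  coefficient.\<close>

definition poly_eval ::
  "('r, 's) ring_scheme \<Rightarrow> ('r, 'a, 'm) module_scheme \<Rightarrow> ('a multiset \<Rightarrow> 'r) \<Rightarrow> 'a" where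
  "poly_eval R M P = (\<Oplus>\<^bsub>M\<^esub>m \<in> {m. P m \<noteq> \<zero>\<^bsub>R\<^esub>}. P m \<odot>\<^bsub>M\<^esub> monom_eval M m)"

definition free_generators ::
  "('r, 's) ring_scheme \<Rightarrow> ('r, 'a, 'm) module_scheme \<Rightarrow> 'a set \<Rightarrow> bool" where
  "free_generators R M B \<longleftrightarrow>
     algebra R M \<and> B \<subseteq> carrier M \<and>
     bij_betw (poly_eval R M) (ring.indexed_pset R B (carrier R)) (carrier M)"

definition free_commutative_algebra ::
  "('r, 's) ring_scheme \<Rightarrow> ('r, 'a, 'm) module_scheme \<Rightarrow> bool" where
  "free_commutative_algebra R M \<longleftrightarrow> algebra R M \<and> (\<exists>B. free_generators R M B)"

text \<open>The algebra of all functions \<open>G \<rightarrow> \<rat>\<close> with pointwise operations.\<close>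

definition function_algebra :: "'g set \<Rightarrow> (rat, 'g \<Rightarrow> rat) module" where
  "function_algebra G =
     \<lparr>carrier = G \<rightarrow>\<^sub>E UNIV,
      monoid.mult = (\<lambda>f g. \<lambda>x\<in>G. f x * g x),
      one = (\<lambda>x\<in>G. 1),
      ring.zero = (\<lambda>x\<in>G. 0),
      ring.add = (\<lambda>f g. \<lambda>x\<in>G. f x + g x),
      smult = (\<lambda>c f. \<lambda>x\<in>G. c * f x)\<rparr>"


subsection \<open>Combinatorial presheaves\<close>

text \<open>The finite subsets of \<^typ>\<open>nat\<close>, with injections between them, serve as the category of
  finite sets with injections, to which they are equivalent.  They contain all the sets
  \<open>[n] = {1..n}\<close> and any two of them have disjoint copies.  Morphisms are extensional functions.\<close>

definition injections :: "nat set \<Rightarrow> nat set \<Rightarrow> (nat \<Rightarrow> nat) set" where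
  "injections J I = {f \<in> J \<rightarrow>\<^sub>E I. inj_on f J}"

definition bijections :: "nat set \<Rightarrow> nat set \<Rightarrow> (nat \<Rightarrow> nat) set" where
  "bijections J I = {f \<in> J \<rightarrow>\<^sub>E I. bij_betw f J I}"

text \<open>\<open>Ob h I\<close> is \<open>h[I]\<close>; for an injection \<open>f\<close> from \<open>J\<close> to \<open>I\<close>, \<open>Pull h J I f\<close> is the map
  \<open>h[f]\<close> from \<open>h[I]\<close> to \<open>h[J]\<close>.  The sets \<open>h[I]\<close> need not be disjoint, so an object is
  always handled together with its ground set, as a pair \<open>(I, a)\<close>.\<close>

record 'a presheaf =
  Ob :: "nat set \<Rightarrow> 'a set"
  Pull :: "nat set \<Rightarrow> nat set \<Rightarrow> (nat \<Rightarrow> nat) \<Rightarrow> 'a \<Rightarrow> 'a"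

text \<open>\<open>Star h I J a b\<close> is \<open>a \<ast> b\<close> for \<open>a \<in> h[I]\<close> and \<open>b \<in> h[J]\<close>.\<close>

record 'a monoid_presheaf = "'a presheaf" +
  Star :: "nat set \<Rightarrow> nat set \<Rightarrow> 'a \<Rightarrow> 'a \<Rightarrow> 'a"
  Unit :: 'a

definition restr :: "('a, 'm) presheaf_scheme \<Rightarrow> nat set \<Rightarrow> nat set \<Rightarrow> 'a \<Rightarrow> 'a" where
  "restr h I J a = Pull h J I (\<lambda>x\<in>J. x) a"

locale combinatorial_presheaf =
  fixes h :: "('a, 'm) presheaf_scheme"
  assumes finite_Ob: "finite I \<Longrightarrow> finite (Ob h I)"
    and Pull_closed:
      "\<lbrakk>finite I; f \<in> injections J I; a \<in> Ob h I\<rbrakk> \<Longrightarrow> Pull h J I f a \<in> Ob h J"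
    and Pull_id: "\<lbrakk>finite I; a \<in> Ob h I\<rbrakk> \<Longrightarrow> Pull h I I (\<lambda>x\<in>I. x) a = a"
    and Pull_comp:
      "\<lbrakk>finite I; f \<in> injections J I; g \<in> injections K J; a \<in> Ob h I\<rbrakk>
        \<Longrightarrow> Pull h K I (compose K f g) a = Pull h K J g (Pull h J I f a)"

locale associative_presheaf = combinatorial_presheaf h
  for h :: "('a, 'm) monoid_presheaf_scheme" +
  assumes Star_closed:
      "\<lbrakk>finite I; finite J; I \<inter> J = {}; a \<in> Ob h I; b \<in> Ob h J\<rbrakk>
        \<Longrightarrow> Star h I J a b \<in> Ob h (I \<union> J)"
    and Star_natural:
      "\<lbrakk>finite I; finite J; I \<inter> J = {}; I' \<inter> J' = {}; f \<in> bijections I' I; g \<in> bijections J' J;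
        a \<in> Ob h I; b \<in> Ob h J\<rbrakk>
        \<Longrightarrow> Pull h (I' \<union> J') (I \<union> J) (\<lambda>x\<in>I' \<union> J'. if x \<in> I' then f x else g x) (Star h I J a b)
          = Star h I' J' (Pull h I' I f a) (Pull h J' J g b)"
    and Star_restr:
      "\<lbrakk>finite I; finite J; I \<inter> J = {}; A \<subseteq> I; B \<subseteq> J; a \<in> Ob h I; b \<in> Ob h J\<rbrakk>
        \<Longrightarrow> restr h (I \<union> J) (A \<union> B) (Star h I J a b) = Star h A B (restr h I A a) (restr h J B b)"
    and Star_assoc:
      "\<lbrakk>finite I; finite J; finite K; I \<inter> J = {}; I \<inter> K = {}; J \<inter> K = {};
        a \<in> Ob h I; b \<in> Ob h J; c \<in> Ob h K\<rbrakk>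
        \<Longrightarrow> Star h (I \<union> J) K (Star h I J a b) c = Star h I (J \<union> K) a (Star h J K b c)"
    and Unit_closed: "Unit h \<in> Ob h {}"
    and Star_Unit_left: "\<lbrakk>finite I; a \<in> Ob h I\<rbrakk> \<Longrightarrow> Star h {} I (Unit h) a = a"
    and Star_Unit_right: "\<lbrakk>finite I; a \<in> Ob h I\<rbrakk> \<Longrightarrow> Star h I {} a (Unit h) = a"

locale commutative_presheaf = associative_presheaf h
  for h :: "('a, 'm) monoid_presheaf_scheme" +
  assumes Star_comm:
      "\<lbrakk>finite I; finite J; I \<inter> J = {}; a \<in> Ob h I; b \<in> Ob h J\<rbrakk>
        \<Longrightarrow> Star h I J a b = Star h J I b a"

definition connected_presheaf :: "('a, 'm) presheaf_scheme \<Rightarrow> bool" where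
  "connected_presheaf h \<longleftrightarrow> card (Ob h {}) = 1"


subsection \<open>Coinvariants, pattern functions and the induced product\<close>

definition sim :: "('a, 'm) presheaf_scheme \<Rightarrow> ((nat set \<times> 'a) \<times> (nat set \<times> 'a)) set" where
  "sim h = {((I, a), (J, b)). finite I \<and> finite J \<and> a \<in> Ob h I \<and> b \<in> Ob h J \<and>
              (\<exists>f \<in> bijections J I. Pull h J I f a = b)}"

text \<open>Related objects have ground sets of equal size, so this quotient is the disjoint union of
  the \<open>h[[n]]/\<sim>\<close>.\<close>

definition std_objects :: "('a, 'm) presheaf_scheme \<Rightarrow> (nat set \<times> 'a) set" where
  "std_objects h = {({1..n}, a) | n a. a \<in> Ob h {1..n}}"

definition coinvariants :: "('a, 'm) presheaf_scheme \<Rightarrow> (nat set \<times> 'a) set set" where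
  "coinvariants h = std_objects h // Restr (sim h) (std_objects h)"

definition coinv_class ::
  "('a, 'm) presheaf_scheme \<Rightarrow> nat set \<times> 'a \<Rightarrow> (nat set \<times> 'a) set" where
  "coinv_class h x = {y \<in> std_objects h. (x, y) \<in> sim h}"

definition pattern_count ::
  "('a, 'm) presheaf_scheme \<Rightarrow> nat set \<times> 'a \<Rightarrow> nat set \<times> 'a \<Rightarrow> nat" where
  "pattern_count h x y =
     (case y of (I, b) \<Rightarrow> card {J. J \<subseteq> I \<and> ((J, restr h I J b), x) \<in> sim h})"

text \<open>The count only depends on the classes, so representatives are chosen arbitrarily.\<close>

definition pattern_fun ::
  "('a, 'm) presheaf_scheme \<Rightarrow> (nat set \<times> 'a) set \<Rightarrow> (nat set \<times> 'a) set \<Rightarrow> rat" where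
  "pattern_fun h \<alpha> =
     (\<lambda>\<beta>\<in>coinvariants h. of_nat (pattern_count h (SOME x. x \<in> \<alpha>) (SOME y. y \<in> \<beta>)))"

definition pattern_algebra ::
  "('a, 'm) presheaf_scheme \<Rightarrow> (rat, (nat set \<times> 'a) set \<Rightarrow> rat) module" where
  "pattern_algebra h =
     (function_algebra (coinvariants h))
       \<lparr>carrier := {(\<lambda>\<beta>\<in>coinvariants h. \<Sum>\<alpha>\<in>S. c \<alpha> * pattern_fun h \<alpha> \<beta>) | S c.
                     finite S \<and> S \<subseteq> coinvariants h}\<rparr>"

definition coinv_prod ::
  "('a, 'm) monoid_presheaf_scheme \<Rightarrow> (nat set \<times> 'a) set \<Rightarrow> (nat set \<times> 'a) set \<Rightarrow>
     (nat set \<times> 'a) set" where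
  "coinv_prod h \<alpha> \<beta> =
     (THE \<gamma>. \<exists>I a y J b'. (I, a) \<in> \<alpha> \<and> y \<in> \<beta> \<and> (y, (J, b')) \<in> sim h \<and> I \<inter> J = {} \<and>
             \<gamma> = coinv_class h (I \<union> J, Star h I J a b'))"

definition coinv_unit :: "('a, 'm) monoid_presheaf_scheme \<Rightarrow> (nat set \<times> 'a) set" where
  "coinv_unit h = coinv_class h ({}, Unit h)"

definition irreducible_coinvariants ::
  "('a, 'm) monoid_presheaf_scheme \<Rightarrow> (nat set \<times> 'a) set set" where
  "irreducible_coinvariants h =
     {\<tau> \<in> coinvariants h. \<tau> \<noteq> coinv_unit h \<and>
        (\<forall>\<alpha>\<in>coinvariants h. \<forall>\<beta>\<in>coinvariants h.
           \<tau> = coinv_prod h \<alpha> \<beta> \<longrightarrow> \<alpha> = coinv_unit h \<or> \<beta> = coinv_unit h)}"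

end

theory Submission
  imports Defs
begin

text \<open>Call \<open>A \<subseteq> I\<close> a splitting set of \<open>c \<in> h[I]\<close> if \<open>c = c|\<^sub>A \<ast> c|\<^sub>I\<^sub>-\<^sub>A\<close>.  Restricting such an equation
  to \<open>J \<subseteq> I\<close> shows that \<open>A \<inter> J\<close> splits \<open>c|\<^sub>J\<close>.  Hence a subset with indecomposable restriction lies
  in a single block of every factorization of \<open>c\<close> into indecomposables, and factorizations, which
  are partitions of \<open>I\<close>, are unique.  So coinvariants correspond to multisets of irreducible ones.

  A product \<open>p\<^sub>\<iota>\<^sub>1 \<dots> p\<^sub>\<iota>\<^sub>k\<close> is the sum of the \<open>p\<^sub>\<gamma>\<close> weighted by the number of covers of \<open>\<gamma>\<close> by
  \<open>k\<close> subsets of types \<open>\<iota>\<^sub>1, \<dots>, \<iota>\<^sub>k\<close>.  Each subset of such a cover lies in a block of \<open>\<gamma>\<close>, so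
  \<open>\<gamma>\<close> has at most \<open>k\<close> irreducible factors, and if it has \<open>k\<close>, then the subsets are the blocks and
  \<open>\<gamma> = \<iota>\<^sub>1 \<cdot> \<dots> \<cdot> \<iota>\<^sub>k\<close>.  The monomials in the \<open>p\<^sub>\<iota>\<close> are therefore triangular over the
  basis of the \<open>p\<^sub>\<gamma>\<close>, with respect to the number of irreducible factors.\<close>

section \<open>Algebras of rational functions\<close>

lemma rat_field_simps [simp]:
  "carrier rat_field = UNIV" "x \<otimes>\<^bsub>rat_field\<^esub> y = x * y" "\<one>\<^bsub>rat_field\<^esub> = 1"
  "\<zero>\<^bsub>rat_field\<^esub> = 0" "x \<oplus>\<^bsub>rat_field\<^esub> y = x + y"
  by (auto simp: rat_field_def)

lemma cring_rat_field: "cring rat_field"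
proof (rule cringI)
  show "abelian_group rat_field"
  proof (rule abelian_groupI)
    fix x assume "x \<in> carrier rat_field"
    show "\<exists>y\<in>carrier rat_field. y \<oplus>\<^bsub>rat_field\<^esub> x = \<zero>\<^bsub>rat_field\<^esub>"
      by (rule bexI[of _ "- x"]) auto
  qed (auto simp: algebra_simps)
  show "comm_monoid rat_field"
    by (rule comm_monoidI) (auto simp: algebra_simps)
qed (auto simp: algebra_simps)

text \<open>The ring and algebra laws hold pointwise, so only closure of \<open>C\<close> is at
  stake. Zero and negatives come from closure under scalars, namely 0 and -1.\<close>

lemma algebra_function_algebra_restrict_carrier:
  assumes C: "C \<subseteq> G \<rightarrow>\<^sub>E UNIV"
    and one: "(\<lambda>x\<in>G. 1) \<in> C"
    and add: "\<And>f g. f \<in> C \<Longrightarrow> g \<in> C \<Longrightarrow> (\<lambda>x\<in>G. f x + g x) \<in> C"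
    and mult: "\<And>f g. f \<in> C \<Longrightarrow> g \<in> C \<Longrightarrow> (\<lambda>x\<in>G. f x * g x) \<in> C"
    and smult: "\<And>c f. f \<in> C \<Longrightarrow> (\<lambda>x\<in>G. c * f x) \<in> C"
  shows "algebra rat_field (function_algebra G \<lparr>carrier := C\<rparr>)" (is "algebra _ ?M")
proof -
  have zero: "(\<lambda>x\<in>G. 0) \<in> C"
    using smult[OF one, of 0] by (simp add: restrict_def cong: if_cong)
  have ext: "f \<in> extensional G" if "f \<in> C" for f
    using that C by (auto simp: PiE_def)
  have eqI: "f = g" if "f \<in> extensional G" "g \<in> extensional G" "\<And>x. x \<in> G \<Longrightarrow> f x = g x"
    for f g :: "_ \<Rightarrow> rat"
    using that by (rule extensionalityI)
  have M: "abelian_group ?M"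
  proof (rule abelian_groupI)
    fix f assume f: "f \<in> carrier ?M"
    show "\<exists>g\<in>carrier ?M. g \<oplus>\<^bsub>?M\<^esub> f = \<zero>\<^bsub>?M\<^esub>"
      using f by (intro bexI[of _ "\<lambda>x\<in>G. (-1) * f x"])
        (use smult[of f "-1"] in \<open>auto simp: function_algebra_def intro!: eqI\<close>)
  qed (auto simp: function_algebra_def ext algebra_simps intro!: eqI add zero)
  have M': "cring ?M"
  proof (rule cringI)
    show "comm_monoid ?M"
      by (rule comm_monoidI)
        (auto simp: function_algebra_def ext algebra_simps intro!: eqI mult one)
  qed (use M in \<open>auto simp: function_algebra_def ext algebra_simps intro!: eqI\<close>)
  show ?thesis
    by (rule algebraI)
      (use M' cring_rat_field in
        \<open>auto simp: function_algebra_def ext algebra_simps intro!: eqI smult\<close>)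
qed

section \<open>Polynomials with rational coefficients and their evaluation at functions\<close>

lemma indexed_pset_rat_field:
  "ring.indexed_pset rat_field B UNIV =
     {P. finite {m. P m \<noteq> 0} \<and> (\<forall>m. P m \<noteq> 0 \<longrightarrow> set_mset m \<subseteq> B)}" (is "?L = ?R")
proof -
  interpret R: cring rat_field by (rule cring_rat_field)
  note defs = R.indexed_const_def R.indexed_padd_def R.indexed_pmult_def
  have "P \<in> ?R" if "P \<in> ?L" for P
    using that
  proof induction
    case (indexed_const k)
    have "finite {m. R.indexed_const k m \<noteq> 0}"
      by (rule finite_subset[of _ "{{#}}"]) (auto simp: defs)
    then show ?case by (auto simp: defs)
  next
    case (indexed_padd P Q)
    have "finite {m. R.indexed_padd P Q m \<noteq> 0}"
      by (rule finite_subset[of _ "{m. P m \<noteq> 0} \<union> {m. Q m \<noteq> 0}"])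
        (use indexed_padd in \<open>auto simp: defs\<close>)
    moreover have "set_mset m \<subseteq> B" if "R.indexed_padd P Q m \<noteq> 0" for m
    proof -
      have "P m \<noteq> 0 \<or> Q m \<noteq> 0" using that by (auto simp: defs)
      then show ?thesis using indexed_padd by blast
    qed
    ultimately show ?case by blast
  next
    case (indexed_pmult P i)
    have "finite {m. R.indexed_pmult P i m \<noteq> 0}"
      by (rule finite_subset[of _ "add_mset i ` {m. P m \<noteq> 0}"])
        (use indexed_pmult in \<open>auto simp: defs image_iff split: if_splits, metis insert_DiffM\<close>)
    moreover have "set_mset m \<subseteq> B" if "R.indexed_pmult P i m \<noteq> 0" for m
    proof -
      have "i \<in># m" "P (m - {#i#}) \<noteq> 0" using that by (auto simp: defs split: if_splits)
      moreover from this have "set_mset (m - {#i#}) \<subseteq> B" using indexed_pmult by blast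
      moreover have "set_mset m = insert i (set_mset (m - {#i#}))"
        using \<open>i \<in># m\<close> by (metis insert_DiffM set_mset_add_mset_insert)
      ultimately show ?thesis using indexed_pmult by simp
    qed
    ultimately show ?case by blast
  qed
  moreover have "P \<in> ?L" if "P \<in> ?R" for P
  proof -
    \<comment> \<open>Single terms arise from the constant \<open>c\<close> by multiplying with one
      variable after another; adding them up over the support then yields \<open>P\<close>.\<close>
    have monom: "(\<lambda>n. if n = m then c else 0) \<in> ?L" if "set_mset m \<subseteq> B" for m c
      using that
    proof (induction m)
      case empty
      then show ?case using R.indexed_pset.indexed_const[of c UNIV B] by (simp add: defs cong: if_cong)
    next
      case (add i m)
      have "R.indexed_pmult (\<lambda>n. if n = m then c else 0) i \<in> ?L"
        using add by (intro R.indexed_pset.indexed_pmult) auto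
      also have "R.indexed_pmult (\<lambda>n. if n = m then c else 0) i =
          (\<lambda>n. if n = add_mset i m then c else 0)"
        by (auto simp: defs fun_eq_iff)
      finally show ?case .
    qed
    have "(\<lambda>n. if n \<in> S then P n else 0) \<in> ?L"
      if "finite S" "S \<subseteq> {m. P m \<noteq> 0}" for S
      using that
    proof (induction S)
      case empty
      then show ?case using R.indexed_pset.indexed_const[of 0 UNIV B] by (simp add: R.indexed_zero_def[simplified])
    next
      case (insert m S)
      have "R.indexed_padd (\<lambda>n. if n = m then P m else 0) (\<lambda>n. if n \<in> S then P n else 0) \<in> ?L"
        using insert \<open>P \<in> ?R\<close> by (intro R.indexed_pset.indexed_padd monom) auto
      also have "R.indexed_padd (\<lambda>n. if n = m then P m else 0) (\<lambda>n. if n \<in> S then P n else 0) =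
          (\<lambda>n. if n \<in> insert m S then P n else 0)"
        using insert by (auto simp: defs fun_eq_iff)
      finally show ?case .
    qed
    from this[of "{m. P m \<noteq> 0}"] have "(\<lambda>n. if P n \<noteq> 0 then P n else 0) \<in> ?L"
      using \<open>P \<in> ?R\<close> by simp
    also have "(\<lambda>n. if P n \<noteq> 0 then P n else 0) = P" by auto
    finally show ?thesis .
  qed
  ultimately show ?thesis by blast
qed

text \<open>Products and sums in the structure \<open>M\<close> become products and sums of
  rationals at each argument, so later arguments work with plain rational expressions.\<close>

lemma poly_eval_function_algebra:
  fixes M :: "(rat, 'g \<Rightarrow> rat) module"
  assumes M: "M = function_algebra G \<lparr>carrier := C\<rparr>" and alg: "algebra rat_field M"
    and C: "C \<subseteq> G \<rightarrow>\<^sub>E UNIV" and "B \<subseteq> C"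
    and P: "finite {m. P m \<noteq> 0}" "\<And>m. P m \<noteq> 0 \<Longrightarrow> set_mset m \<subseteq> B"
  shows "poly_eval rat_field M P = (\<lambda>x\<in>G. \<Sum>m | P m \<noteq> 0. P m * (\<Prod>f\<in>#m. f x))"
proof -
  interpret A: algebra rat_field M by (rule alg)
  have [simp]: "carrier M = C" by (simp add: M)
  have ops: "\<one>\<^bsub>M\<^esub> = (\<lambda>x\<in>G. 1)" "\<zero>\<^bsub>M\<^esub> = (\<lambda>x\<in>G. 0)"
    "f \<otimes>\<^bsub>M\<^esub> g = (\<lambda>x\<in>G. f x * g x)" "f \<oplus>\<^bsub>M\<^esub> g = (\<lambda>x\<in>G. f x + g x)"
    "c \<odot>\<^bsub>M\<^esub> f = (\<lambda>x\<in>G. c * f x)" for f g c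
    by (simp_all add: M function_algebra_def)
  have smult_closed: "c \<odot>\<^bsub>M\<^esub> f \<in> C" if "f \<in> C" for c f
    using A.smult_closed[of c f] that by simp
  have pow: "f [^]\<^bsub>M\<^esub> (k::nat) = (\<lambda>x\<in>G. f x ^ k)" if "f \<in> C" for f k
    using that by (induction k) (auto simp: ops fun_eq_iff)
  have pow_closed: "f [^]\<^bsub>M\<^esub> (k::nat) \<in> C" if "f \<in> C" for f k
    using A.nat_pow_closed[of f k] that by simp
  have "finprod M (\<lambda>f. f [^]\<^bsub>M\<^esub> k f) F = (\<lambda>x\<in>G. \<Prod>f\<in>F. f x ^ k f)"
    if "finite F" "F \<subseteq> C" for F and k :: "_ \<Rightarrow> nat"
    using that
  proof (induction F)
    case empty
    then show ?case by (simp add: ops restrict_def cong: if_cong)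
  next
    case (insert f F)
    have "finprod M (\<lambda>f. f [^]\<^bsub>M\<^esub> k f) (insert f F) =
        f [^]\<^bsub>M\<^esub> k f \<otimes>\<^bsub>M\<^esub> finprod M (\<lambda>f. f [^]\<^bsub>M\<^esub> k f) F"
      using insert by (intro A.finprod_insert) (auto intro: pow_closed)
    also have "\<dots> = (\<lambda>x\<in>G. \<Prod>f\<in>insert f F. f x ^ k f)"
      using insert by (simp add: pow) (auto simp: ops fun_eq_iff)
    finally show ?case .
  qed
  then have monom: "monom_eval M m = (\<lambda>x\<in>G. \<Prod>f\<in>#m. f x)" if "set_mset m \<subseteq> C" for m
    using that by (simp add: monom_eval_def image_prod_mset_multiplicity)
  have monom_closed: "monom_eval M m \<in> C" if "set_mset m \<subseteq> C" for m
    using that A.finprod_closed[of "\<lambda>f. f [^]\<^bsub>M\<^esub> count m f" "set_mset m"]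
    by (auto simp: monom_eval_def intro: pow_closed)
  have "finsum M (\<lambda>m. P m \<odot>\<^bsub>M\<^esub> monom_eval M m) S = (\<lambda>x\<in>G. \<Sum>m\<in>S. P m * (\<Prod>f\<in>#m. f x))"
    if "finite S" "\<And>m. m \<in> S \<Longrightarrow> set_mset m \<subseteq> C" for S
    using that
  proof (induction S)
    case empty
    then show ?case by (auto simp: ops fun_eq_iff)
  next
    case (insert m S)
    have "finsum M (\<lambda>m. P m \<odot>\<^bsub>M\<^esub> monom_eval M m) (insert m S) =
        P m \<odot>\<^bsub>M\<^esub> monom_eval M m \<oplus>\<^bsub>M\<^esub> finsum M (\<lambda>m. P m \<odot>\<^bsub>M\<^esub> monom_eval M m) S"
      using insert by (intro A.M.finsum_insert) (auto intro!: monom_closed smult_closed)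
    also have "\<dots> = (\<lambda>x\<in>G. \<Sum>m\<in>insert m S. P m * (\<Prod>f\<in>#m. f x))"
      using insert by (simp add: monom) (auto simp: ops fun_eq_iff)
    finally show ?case .
  qed
  from this[OF P(1)] show ?thesis
    using P(2) \<open>B \<subseteq> C\<close> by (force simp: poly_eval_def)
qed

section \<open>Linear combinations, independence and triangular change of basis\<close>

definition lincomb_on ::
  "'x set \<Rightarrow> 'i set \<Rightarrow> ('i \<Rightarrow> 'x \<Rightarrow> rat) \<Rightarrow> ('x \<Rightarrow> rat) \<Rightarrow> bool" where
  "lincomb_on Y S Q f \<longleftrightarrow>
     (\<exists>T c. finite T \<and> T \<subseteq> S \<and> (\<forall>x\<in>Y. f x = (\<Sum>i\<in>T. c i * Q i x)))"

text \<open>Coefficients belong to indices rather than to functions, so independence also forces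
  functions with different indices to differ on \<open>Y\<close>.\<close>

definition independent_on :: "'x set \<Rightarrow> 'i set \<Rightarrow> ('i \<Rightarrow> 'x \<Rightarrow> rat) \<Rightarrow> bool" where
  "independent_on Y S Q \<longleftrightarrow>
     (\<forall>T c. finite T \<longrightarrow> T \<subseteq> S \<longrightarrow> (\<forall>x\<in>Y. (\<Sum>i\<in>T. c i * Q i x) = 0) \<longrightarrow> (\<forall>i\<in>T. c i = 0))"

lemma independent_onD:
  assumes "independent_on Y S Q" "finite T" "T \<subseteq> S"
    and "\<And>x. x \<in> Y \<Longrightarrow> (\<Sum>i\<in>T. c i * Q i x) = 0" and "i \<in> T"
  shows "c i = 0"
  using assms unfolding independent_on_def by blast

lemma lincomb_on_zero: "(\<And>x. x \<in> Y \<Longrightarrow> f x = 0) \<Longrightarrow> lincomb_on Y S Q f"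
  unfolding lincomb_on_def by (rule exI[of _ "{}"]) simp

lemma lincomb_on_base: "i \<in> S \<Longrightarrow> lincomb_on Y S Q (Q i)"
  unfolding lincomb_on_def by (rule exI[of _ "{i}"], rule exI[of _ "\<lambda>_. 1"]) simp

lemma lincomb_on_cong:
  "lincomb_on Y S Q g \<Longrightarrow> (\<And>x. x \<in> Y \<Longrightarrow> f x = g x) \<Longrightarrow> lincomb_on Y S Q f"
  unfolding lincomb_on_def by simp

lemma lincomb_on_smult:
  assumes "lincomb_on Y S Q f"
  shows "lincomb_on Y S Q (\<lambda>x. a * f x)"
proof -
  obtain T c where T: "finite T" "T \<subseteq> S" "\<And>x. x \<in> Y \<Longrightarrow> f x = (\<Sum>i\<in>T. c i * Q i x)"
    using assms unfolding lincomb_on_def by blast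
  then show ?thesis
    unfolding lincomb_on_def
    by (intro exI[of _ T] exI[of _ "\<lambda>i. a * c i"]) (simp add: sum_distrib_left mult.assoc)
qed

lemma lincomb_on_add:
  assumes "lincomb_on Y S Q f" "lincomb_on Y S Q g"
  shows "lincomb_on Y S Q (\<lambda>x. f x + g x)"
proof -
  obtain T c where T: "finite T" "T \<subseteq> S" "\<And>x. x \<in> Y \<Longrightarrow> f x = (\<Sum>i\<in>T. c i * Q i x)"
    using assms unfolding lincomb_on_def by blast
  obtain U d where U: "finite U" "U \<subseteq> S" "\<And>x. x \<in> Y \<Longrightarrow> g x = (\<Sum>i\<in>U. d i * Q i x)"
    using assms unfolding lincomb_on_def by blast
  have extend: "(\<Sum>i\<in>V. e i * Q i x) = (\<Sum>i\<in>T \<union> U. (if i \<in> V then e i else 0) * Q i x)"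
    if "V \<subseteq> T \<union> U" for V e x
  proof -
    have "(\<Sum>i\<in>V. e i * Q i x) = (\<Sum>i\<in>V. (if i \<in> V then e i else 0) * Q i x)"
      by (intro sum.cong) auto
    also have "\<dots> = (\<Sum>i\<in>T \<union> U. (if i \<in> V then e i else 0) * Q i x)"
      using that T U by (intro sum.mono_neutral_left) auto
    finally show ?thesis .
  qed
  have "f x + g x =
      (\<Sum>i\<in>T \<union> U. ((if i \<in> T then c i else 0) + (if i \<in> U then d i else 0)) * Q i x)"
    if "x \<in> Y" for x
    using that T(3) U(3) extend[of T c x] extend[of U d x] by (simp only: distrib_right sum.distrib Un_upper1 Un_upper2)
  then show ?thesis
    unfolding lincomb_on_def using T U
    by (intro exI[of _ "T \<union> U"] exI[of _ "\<lambda>i. (if i \<in> T then c i else 0) + (if i \<in> U then d i else 0)"])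
      simp
qed

lemma lincomb_on_sum:
  assumes "\<And>t. t \<in> T \<Longrightarrow> lincomb_on Y S Q (f t)"
  shows "lincomb_on Y S Q (\<lambda>x. \<Sum>t\<in>T. f t x)"
  using assms
  by (induction T rule: infinite_finite_induct) (auto intro: lincomb_on_zero lincomb_on_add)

lemma lincomb_on_trans:
  assumes "lincomb_on Y S Q f" "\<And>i. i \<in> S \<Longrightarrow> lincomb_on Y S' Q' (Q i)"
  shows "lincomb_on Y S' Q' f"
proof -
  obtain T c where T: "T \<subseteq> S" "\<And>x. x \<in> Y \<Longrightarrow> f x = (\<Sum>i\<in>T. c i * Q i x)"
    using assms unfolding lincomb_on_def by blast
  have "lincomb_on Y S' Q' (\<lambda>x. \<Sum>i\<in>T. c i * Q i x)"
    using T(1) assms(2) by (intro lincomb_on_sum lincomb_on_smult) blast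
  then show ?thesis using T(2) by (rule lincomb_on_cong)
qed

text \<open>The matrix \<open>k\<close> writes the family \<open>Q\<close> through the family
  \<open>p\<close>, with finite rows \<open>K m\<close>. After matching indices by
  \<open>\<Psi>\<close> it is triangular for the rank \<open>r\<close>, with nonzero diagonal.
  Different indices may share a rank, and natural number ranks allow induction although
  \<open>G\<close> and \<open>M\<close> may be infinite.\<close>

locale triangular_family =
  fixes Y :: "'x set" and G :: "'g set" and M :: "'m set"
    and p :: "'g \<Rightarrow> 'x \<Rightarrow> rat" and Q :: "'m \<Rightarrow> 'x \<Rightarrow> rat"
    and \<Psi> :: "'g \<Rightarrow> 'm" and K :: "'m \<Rightarrow> 'g set" and k :: "'m \<Rightarrow> 'g \<Rightarrow> rat" and r :: "'m \<Rightarrow> nat"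
  assumes bij: "bij_betw \<Psi> G M"
    and expand: "\<lbrakk>m \<in> M; x \<in> Y\<rbrakk> \<Longrightarrow> Q m x = (\<Sum>\<gamma>\<in>K m. k m \<gamma> * p \<gamma> x)"
    and finite_K: "m \<in> M \<Longrightarrow> finite (K m)" and K_subset: "m \<in> M \<Longrightarrow> K m \<subseteq> G"
    and triangular: "\<lbrakk>m \<in> M; \<gamma> \<in> K m\<rbrakk> \<Longrightarrow> \<Psi> \<gamma> = m \<or> r (\<Psi> \<gamma>) < r m"
    and diagonal: "\<gamma> \<in> G \<Longrightarrow> \<gamma> \<in> K (\<Psi> \<gamma>) \<and> k (\<Psi> \<gamma>) \<gamma> \<noteq> 0"
begin

text \<open>Back substitution, by induction on the rank: row \<open>\<Psi> \<gamma>\<close>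
  expresses \<open>p \<gamma>\<close> through \<open>Q (\<Psi> \<gamma>)\<close> and functions
  \<open>p \<delta>\<close> of smaller rank, because by injectivity of \<open>\<Psi>\<close> no
  other index of the row is diagonal.\<close>

lemma lincomb_on_expand: "\<gamma> \<in> G \<Longrightarrow> lincomb_on Y M Q (p \<gamma>)"
proof (induction "r (\<Psi> \<gamma>)" arbitrary: \<gamma> rule: less_induct)
  case less
  define m where "m = \<Psi> \<gamma>"
  have m: "m \<in> M" using bij less.prems by (auto simp: m_def bij_betw_def)
  have d: "\<gamma> \<in> K m" "k m \<gamma> \<noteq> 0" using diagonal[OF less.prems] by (auto simp: m_def)
  have lower: "lincomb_on Y M Q (p \<delta>)" if "\<delta> \<in> K m - {\<gamma>}" for \<delta>
  proof -
    have "\<delta> \<in> G" "\<delta> \<noteq> \<gamma>" using that K_subset[OF m] by auto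
    then have "\<Psi> \<delta> \<noteq> m" using bij less.prems by (auto simp: m_def bij_betw_def inj_on_def)
    then have "r (\<Psi> \<delta>) < r (\<Psi> \<gamma>)" using triangular[OF m, of \<delta>] that by (auto simp: m_def)
    then show ?thesis using less.hyps \<open>\<delta> \<in> G\<close> by blast
  qed
  have "p \<gamma> x = (1 / k m \<gamma>) * (Q m x + (\<Sum>\<delta>\<in>K m - {\<gamma>}. (- k m \<delta>) * p \<delta> x))" if "x \<in> Y" for x
  proof -
    have "Q m x = k m \<gamma> * p \<gamma> x + (\<Sum>\<delta>\<in>K m - {\<gamma>}. k m \<delta> * p \<delta> x)"
      using expand[OF m that] sum.remove[OF finite_K[OF m] d(1), of "\<lambda>\<delta>. k m \<delta> * p \<delta> x"] by simp
    then show ?thesis using d(2) by (simp add: sum_negf)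
  qed
  moreover have
    "lincomb_on Y M Q (\<lambda>x. (1 / k m \<gamma>) * (Q m x + (\<Sum>\<delta>\<in>K m - {\<gamma>}. (- k m \<delta>) * p \<delta> x)))"
    by (intro lincomb_on_smult lincomb_on_add lincomb_on_sum lincomb_on_base m lower)
  ultimately show ?case by (rule lincomb_on_cong[rotated])
qed

text \<open>In a nontrivial relation among the \<open>Q m\<close>, choose \<open>m\<close> of
  maximal rank with nonzero coefficient. After substituting the rows, the diagonal function of row
  \<open>m\<close> comes only from \<open>Q m\<close>, so its coefficient is nonzero, against the
  independence of \<open>p\<close>.\<close>

lemma independent_on_triangular:
  assumes indep: "independent_on Y G p"
  shows "independent_on Y M Q"
  unfolding independent_on_def
proof (intro allI impI, rule ccontr)
  fix T c
  assume T: "finite T" "T \<subseteq> M" and zero: "\<forall>x\<in>Y. (\<Sum>m\<in>T. c m * Q m x) = 0"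
    and "\<not> (\<forall>m\<in>T. c m = 0)"
  define T' where "T' = {m \<in> T. c m \<noteq> 0}"
  have T': "finite T'" "T' \<subseteq> M" "T' \<noteq> {}"
    using T \<open>\<not> (\<forall>m\<in>T. c m = 0)\<close> by (auto simp: T'_def)
  then obtain m where m: "m \<in> T'" "\<And>n. n \<in> T' \<Longrightarrow> r n \<le> r m"
    using Max_in[of "r ` T'"] Max_ge[of "r ` T'"] by (metis (no_types, lifting) empty_is_image finite_imageI imageE imageI)
  obtain \<gamma> where \<gamma>: "\<gamma> \<in> G" "\<Psi> \<gamma> = m"
    using bij m(1) T'(2) by (auto simp: bij_betw_def)
  define U where "U = (\<Union>n\<in>T'. K n)"
  have U: "finite U" "U \<subseteq> G" using T' finite_K K_subset by (auto simp: U_def)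
  define d where "d \<delta> = (\<Sum>n\<in>T'. c n * (if \<delta> \<in> K n then k n \<delta> else 0))" for \<delta>
  have "(\<Sum>\<delta>\<in>U. d \<delta> * p \<delta> x) = 0" if x: "x \<in> Y" for x
  proof -
    have "(\<Sum>n\<in>T. c n * Q n x) = (\<Sum>n\<in>T'. c n * Q n x)"
      using T by (intro sum.mono_neutral_right) (auto simp: T'_def)
    also have "\<dots> = (\<Sum>n\<in>T'. c n * (\<Sum>\<delta>\<in>U. (if \<delta> \<in> K n then k n \<delta> else 0) * p \<delta> x))"
    proof (intro sum.cong refl arg_cong2[of _ _ _ _ "(*)"])
      fix n assume n: "n \<in> T'"
      have "Q n x = (\<Sum>\<delta>\<in>K n. (if \<delta> \<in> K n then k n \<delta> else 0) * p \<delta> x)"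
        using expand n T' x by (simp add: subset_iff cong: sum.cong)
      also have "\<dots> = (\<Sum>\<delta>\<in>U. (if \<delta> \<in> K n then k n \<delta> else 0) * p \<delta> x)"
        using U n by (intro sum.mono_neutral_left) (auto simp: U_def)
      finally show "Q n x = \<dots>" .
    qed
    also have "\<dots> = (\<Sum>n\<in>T'. \<Sum>\<delta>\<in>U. c n * (if \<delta> \<in> K n then k n \<delta> else 0) * p \<delta> x)"
      by (simp only: sum_distrib_left mult.assoc)
    also have "\<dots> = (\<Sum>\<delta>\<in>U. \<Sum>n\<in>T'. c n * (if \<delta> \<in> K n then k n \<delta> else 0) * p \<delta> x)"
      by (rule sum.swap)
    also have "\<dots> = (\<Sum>\<delta>\<in>U. d \<delta> * p \<delta> x)"
      by (simp only: d_def sum_distrib_right)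
    finally show ?thesis using zero x by simp
  qed
  then have "\<forall>\<delta>\<in>U. d \<delta> = 0"
    using independent_onD[OF indep U, of d] by blast
  moreover have "\<gamma> \<in> U" using diagonal[OF \<gamma>(1)] \<gamma> m by (auto simp: U_def)
  ultimately have "d \<gamma> = 0" by blast
  \<comment> \<open>Another row \<open>n\<close> containing \<open>\<gamma>\<close> would have a
    rank above that of \<open>m\<close>, contrary to the choice of \<open>m\<close>.\<close>
  moreover have "d \<gamma> = (\<Sum>n\<in>{m}. c n * (if \<gamma> \<in> K n then k n \<gamma> else 0))"
    unfolding d_def
  proof (intro sum.mono_neutral_right ballI)
    fix n assume n: "n \<in> T' - {m}"
    have "\<gamma> \<notin> K n" using triangular[of n \<gamma>] m(2)[of n] n T' \<gamma> by auto
    then show "c n * (if \<gamma> \<in> K n then k n \<gamma> else 0) = 0" by simp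
  qed (use m T' in auto)
  ultimately show False using diagonal[OF \<gamma>(1)] \<gamma> m(1) by (auto simp: T'_def)
qed

end

text \<open>Spanning by monomials gives surjectivity of evaluation, and their independence gives
  injectivity. The variables in \<open>free_generators\<close> are the functions themselves, so
  injectivity of \<open>p\<close> identifies their monomials with multisets over
  \<open>I\<close>.\<close>

lemma free_generators_function_algebra:
  fixes M :: "(rat, 'g \<Rightarrow> rat) module"
  assumes M: "M = function_algebra Y \<lparr>carrier := C\<rparr>" and alg: "algebra rat_field M"
    and C: "C \<subseteq> Y \<rightarrow>\<^sub>E UNIV"
    and p: "inj_on p I" "p ` I \<subseteq> C"
    and span: "\<And>f. f \<in> C \<Longrightarrow> lincomb_on Y {m. set_mset m \<subseteq> I} (\<lambda>m x. \<Prod>i\<in>#m. p i x) f"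
    and indep: "independent_on Y {m. set_mset m \<subseteq> I} (\<lambda>m x. \<Prod>i\<in>#m. p i x)"
  shows "free_generators rat_field M (p ` I)"
proof -
  let ?N = "{m. set_mset m \<subseteq> I}"
  let ?e = "image_mset p"
  let ?S = "{P :: ('g \<Rightarrow> rat) multiset \<Rightarrow> rat. finite {m. P m \<noteq> 0} \<and> (\<forall>m. P m \<noteq> 0 \<longrightarrow> set_mset m \<subseteq> p ` I)}"
  have inj: "inj_on ?e ?N"
  proof (rule inj_on_inverseI)
    fix m assume "m \<in> ?N"
    then show "image_mset (inv_into I p) (?e m) = m"
      using p(1) by (auto simp: multiset.map_comp comp_def subset_iff intro!: multiset.map_ident_strong)
  qed
  have range: "set_mset m \<subseteq> p ` I \<longleftrightarrow> m \<in> ?e ` ?N" for m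
  proof
    assume m: "set_mset m \<subseteq> p ` I"
    have "m = ?e (image_mset (inv_into I p) m)"
      using m by (auto simp: multiset.map_comp comp_def subset_iff f_inv_into_f intro!: multiset.map_ident_strong[symmetric])
    moreover have "image_mset (inv_into I p) m \<in> ?N"
      using m by (auto simp: inv_into_into)
    ultimately show "m \<in> ?e ` ?N" by blast
  qed force
  \<comment> \<open>Any finite \<open>T\<close> whose image contains the support is allowed, so that
    two polynomials can be evaluated over a common index set.\<close>
  have eval: "poly_eval rat_field M P = (\<lambda>x\<in>Y. \<Sum>m\<in>T. P (?e m) * (\<Prod>i\<in>#m. p i x))"
    if "P \<in> ?S" "finite T" "T \<subseteq> ?N" "{m. P m \<noteq> 0} \<subseteq> ?e ` T" for P T
  proof -
    have "poly_eval rat_field M P = (\<lambda>x\<in>Y. \<Sum>m | P m \<noteq> 0. P m * (\<Prod>f\<in>#m. f x))"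
      using that(1) by (intro poly_eval_function_algebra[OF M alg C p(2)]) auto
    also have "\<dots> = (\<lambda>x\<in>Y. \<Sum>m\<in>?e ` T. P m * (\<Prod>f\<in>#m. f x))"
      using that by (intro restrict_ext sum.mono_neutral_left) auto
    also have "\<dots> = (\<lambda>x\<in>Y. \<Sum>m\<in>T. P (?e m) * (\<Prod>i\<in>#m. p i x))"
      using inj_on_subset[OF inj that(3)] by (simp add: sum.reindex multiset.map_comp comp_def)
    finally show ?thesis .
  qed
  have support: "\<exists>T. finite T \<and> T \<subseteq> ?N \<and> {m. P m \<noteq> 0} = ?e ` T" if "P \<in> ?S" for P
  proof -
    have "{m. P m \<noteq> 0} \<subseteq> ?e ` ?N" using that range by blast
    then show ?thesis using that finite_subset_image[of "{m. P m \<noteq> 0}" ?e ?N] by blast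
  qed
  have "bij_betw (poly_eval rat_field M) ?S C"
  proof (rule bij_betwI')
    fix P P' assume P: "P \<in> ?S" and P': "P' \<in> ?S"
    obtain T where T: "finite T" "T \<subseteq> ?N" "{m. P m \<noteq> 0} = ?e ` T"
      using support[OF P] by (elim exE conjE)
    obtain T' where T': "finite T'" "T' \<subseteq> ?N" "{m. P' m \<noteq> 0} = ?e ` T'"
      using support[OF P'] by (elim exE conjE)
    have TT': "finite (T \<union> T')" "T \<union> T' \<subseteq> ?N" "{m. P m \<noteq> 0} \<subseteq> ?e ` (T \<union> T')"
        "{m. P' m \<noteq> 0} \<subseteq> ?e ` (T \<union> T')"
      using T T' by auto
    show "poly_eval rat_field M P = poly_eval rat_field M P' \<longleftrightarrow> P = P'"
    proof
      assume eq: "poly_eval rat_field M P = poly_eval rat_field M P'"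
      have "(\<Sum>m\<in>T \<union> T'. (P (?e m) - P' (?e m)) * (\<Prod>i\<in>#m. p i x)) = 0" if "x \<in> Y" for x
        using fun_cong[OF eq, of x] that
        unfolding eval[OF P TT'(1-3)] eval[OF P' TT'(1,2,4)]
        by (simp add: left_diff_distrib sum_subtractf)
      then have "P (?e m) - P' (?e m) = 0" if "m \<in> T \<union> T'" for m
        by (rule independent_onD[OF indep TT'(1,2), where c = "\<lambda>m. P (?e m) - P' (?e m)", OF _ that])
      moreover have "P n = 0" "P' n = 0" if "n \<notin> ?e ` (T \<union> T')" for n
        using that TT'(3,4) by blast+
      ultimately show "P = P'" by (metis (no_types, lifting) eq_iff_diff_eq_0 ext imageE)
    qed simp
  next
    fix P assume P: "P \<in> ?S"
    interpret A: algebra rat_field M by (rule alg)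
    have carr: "carrier M = C" by (simp add: M)
    have closed: "m \<in> ?N \<Longrightarrow> monom_eval M (?e m) \<in> carrier M" for m
      unfolding monom_eval_def using p(2)
      by (intro A.finprod_closed) (auto simp: carr intro!: A.nat_pow_closed[unfolded carr])
    show "poly_eval rat_field M P \<in> C"
    proof -
      have "poly_eval rat_field M P \<in> carrier M"
        unfolding poly_eval_def
        using P range closed by (intro A.M.finsum_closed) (auto intro!: A.smult_closed)
      then show ?thesis by (simp add: M)
    qed
  next
    fix f assume f: "f \<in> C"
    obtain T c where T: "finite T" "T \<subseteq> ?N"
        "\<And>x. x \<in> Y \<Longrightarrow> f x = (\<Sum>m\<in>T. c m * (\<Prod>i\<in>#m. p i x))"
      using span[OF f] unfolding lincomb_on_def by blast
    \<comment> \<open>The preimage polynomial carries the coefficients \<open>c\<close> along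
      \<open>?e\<close> and is 0 on monomials outside the image of \<open>T\<close>.\<close>
    define P where "P m = (if m \<in> ?e ` T then c (inv_into ?N ?e m) else 0)" for m
    have supp: "{m. P m \<noteq> 0} \<subseteq> ?e ` T" by (auto simp: P_def)
    have P: "P \<in> ?S"
      using supp T range finite_subset[OF supp] by blast
    have "P (?e m) = c m" if "m \<in> T" for m
      using that T(2) inv_into_f_f[OF inj, of m] by (auto simp: P_def)
    then have "poly_eval rat_field M P = (\<lambda>x\<in>Y. \<Sum>m\<in>T. c m * (\<Prod>i\<in>#m. p i x))"
      unfolding eval[OF P T(1,2) supp] by (intro restrict_ext sum.cong) auto
    also have "\<dots> = (\<lambda>x\<in>Y. f x)" using T(3) by (intro restrict_ext) simp
    also have "\<dots> = f" using f C by (auto simp: PiE_def extensional_restrict)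
    finally show "\<exists>P\<in>?S. f = poly_eval rat_field M P" using P by auto
  qed
  then show ?thesis
    using alg p(2) unfolding free_generators_def by (simp add: indexed_pset_rat_field M)
qed

section \<open>Coinvariants\<close>

lemma bijections_into_injections: "f \<in> bijections J I \<Longrightarrow> f \<in> injections J I"
  by (auto simp: bijections_def injections_def bij_betw_def)

context combinatorial_presheaf
begin

abbreviation cls :: "nat set \<Rightarrow> 'a \<Rightarrow> (nat set \<times> 'a) set" where
  "cls I a \<equiv> coinv_class h (I, a)"

lemma restr_closed: "\<lbrakk>finite I; J \<subseteq> I; a \<in> Ob h I\<rbrakk> \<Longrightarrow> restr h I J a \<in> Ob h J"
  unfolding restr_def by (rule Pull_closed) (auto simp: injections_def inj_on_def)

lemma restr_self: "\<lbrakk>finite I; a \<in> Ob h I\<rbrakk> \<Longrightarrow> restr h I I a = a"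
  by (simp add: restr_def Pull_id)

lemma restr_restr:
  assumes "finite I" "a \<in> Ob h I" "J \<subseteq> I" "K \<subseteq> J"
  shows "restr h J K (restr h I J a) = restr h I K a"
proof -
  have "compose K (\<lambda>x\<in>J. x) (\<lambda>x\<in>K. x) = (\<lambda>x\<in>K. x)"
    using assms by (auto simp: compose_def fun_eq_iff)
  then show ?thesis
    unfolding restr_def
    using Pull_comp[of I "\<lambda>x\<in>J. x" J "\<lambda>x\<in>K. x" K a] assms
    by (simp add: injections_def inj_on_def subset_iff)
qed

text \<open>Both sides pull \<open>a\<close> back along the same injection from \<open>L\<close>
  into \<open>I\<close>: once factored as the inclusion of \<open>L\<close> followed by
  \<open>f\<close>, once as \<open>f\<close> restricted to \<open>L\<close> followed by the
  inclusion of its image.\<close>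

lemma restr_Pull:
  assumes "finite I" "a \<in> Ob h I" "f \<in> injections J I" "L \<subseteq> J"
  shows "restr h J L (Pull h J I f a) = Pull h L (f ` L) (restrict f L) (restr h I (f ` L) a)"
proof -
  have f: "inj_on f J" "f \<in> J \<rightarrow> I" using assms(3) by (auto simp: injections_def)
  then have "f ` L \<subseteq> I" using assms(4) by auto
  have "compose L (\<lambda>x\<in>f ` L. x) (restrict f L) = compose L f (\<lambda>x\<in>L. x)"
    using assms(4) by (auto simp: compose_def fun_eq_iff)
  moreover have "(\<lambda>x\<in>f ` L. x) \<in> injections (f ` L) I" "(\<lambda>x\<in>L. x) \<in> injections L J"
    "restrict f L \<in> injections L (f ` L)"
    using f assms(4) \<open>f ` L \<subseteq> I\<close> by (auto simp: injections_def inj_on_def)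
  ultimately show ?thesis
    unfolding restr_def using assms Pull_comp[of I f J "\<lambda>x\<in>L. x" L a]
      Pull_comp[of I "\<lambda>x\<in>f ` L. x" "f ` L" "restrict f L" L a] by metis
qed

lemma simI:
  "\<lbrakk>finite I; a \<in> Ob h I; f \<in> bijections J I; b = Pull h J I f a\<rbrakk> \<Longrightarrow> ((I, a), (J, b)) \<in> sim h"
  using Pull_closed[OF _ bijections_into_injections]
  by (auto simp: sim_def bijections_def dest: bij_betw_finite)

lemma simE:
  assumes "((I, a), (J, b)) \<in> sim h"
  obtains f where "f \<in> bijections J I" "b = Pull h J I f a" "finite I" "finite J"
    "a \<in> Ob h I" "b \<in> Ob h J"
  using assms by (auto simp: sim_def)

lemma sim_refl: "\<lbrakk>finite I; a \<in> Ob h I\<rbrakk> \<Longrightarrow> ((I, a), (I, a)) \<in> sim h"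
  by (rule simI[of _ _ "\<lambda>x\<in>I. x"]) (auto simp: bijections_def bij_betw_def inj_on_def Pull_id)

lemma bijections_inverse:
  assumes "finite I" "a \<in> Ob h I" "f \<in> bijections J I"
  obtains g where "g \<in> bijections I J" "a = Pull h I J g (Pull h J I f a)"
    "\<forall>x\<in>J. g (f x) = x" "\<forall>y\<in>I. f (g y) = y"
proof
  define g where "g = restrict (inv_into J f) I"
  have bij: "bij_betw f J I" using assms(3) by (auto simp: bijections_def)
  then have "bij_betw (inv_into J f) I J" by (rule bij_betw_inv_into)
  then show g: "g \<in> bijections I J"
    by (auto simp: bijections_def g_def bij_betw_apply intro: bij_betw_cong[THEN iffD1, rotated])
  show "\<forall>x\<in>J. g (f x) = x" "\<forall>y\<in>I. f (g y) = y"
    using bij by (auto simp: g_def bij_betw_inv_into_right bij_betw_inv_into_left bij_betw_apply)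
  then have "compose I f g = (\<lambda>x\<in>I. x)"
    by (auto simp: compose_def fun_eq_iff)
  then show "a = Pull h I J g (Pull h J I f a)"
    using Pull_comp[of I f J g I a] assms g Pull_id[of I a] by (simp add: bijections_into_injections)
qed

lemma sim_sym:
  assumes "((I, a), (J, b)) \<in> sim h"
  shows "((J, b), (I, a)) \<in> sim h"
  using assms
proof (rule simE)
  fix f
  assume f: "f \<in> bijections J I" "b = Pull h J I f a" and fin: "finite I" "finite J"
    and ab: "a \<in> Ob h I" "b \<in> Ob h J"
  obtain g where "g \<in> bijections I J" "a = Pull h I J g b"
    using bijections_inverse[OF fin(1) ab(1) f(1)] f(2) by metis
  then show ?thesis using simI fin ab by blast
qed

lemma sim_trans:
  assumes "((I, a), (J, b)) \<in> sim h" "((J, b), (K, c)) \<in> sim h"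
  shows "((I, a), (K, c)) \<in> sim h"
  using assms(1)
proof (rule simE)
  fix f assume f: "f \<in> bijections J I" "b = Pull h J I f a" and fin: "finite I" "a \<in> Ob h I"
  obtain g where g: "g \<in> bijections K J" "c = Pull h K J g b"
    using assms(2) by (rule simE)
  have "bij_betw (compose K f g) K I"
    using f g by (auto simp: bijections_def intro: bij_betw_compose)
  then have "compose K f g \<in> bijections K I"
    by (auto simp: bijections_def bij_betw_apply extensional_funcset_def)
  moreover have "Pull h K I (compose K f g) a = c"
    unfolding g(2) f(2)
    by (rule Pull_comp[OF fin(1) f(1)[THEN bijections_into_injections]
          g(1)[THEN bijections_into_injections] fin(2)])
  ultimately show ?thesis using simI[OF fin] by blast
qed

lemma sim_card: "((I, a), (J, b)) \<in> sim h \<Longrightarrow> card I = card J"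
  by (erule simE) (auto simp: bijections_def intro: bij_betw_same_card[symmetric])

lemma sim_restr:
  assumes "finite I" "a \<in> Ob h I" "f \<in> bijections J I" "L \<subseteq> J"
  shows "((f ` L, restr h I (f ` L) a), (L, restr h J L (Pull h J I f a))) \<in> sim h"
proof -
  have f: "inj_on f J" "f ` J = I" using assms(3) by (auto simp: bijections_def bij_betw_def)
  then have sub: "f ` L \<subseteq> I" using assms(4) by auto
  have "bij_betw (restrict f L) L (f ` L)"
    using f assms(4) by (auto simp: bij_betw_def inj_on_def)
  then have "restrict f L \<in> bijections L (f ` L)" by (auto simp: bijections_def)
  then show ?thesis
    using restr_Pull[OF assms(1,2) bijections_into_injections[OF assms(3)] assms(4)] sub assms
    by (intro simI) (auto intro: finite_subset restr_closed)
qed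

lemma sim_relabel:
  assumes "finite I" "a \<in> Ob h I" "finite J" "card J = card I"
  shows "\<exists>b. ((I, a), (J, b)) \<in> sim h"
proof -
  obtain f where f: "bij_betw f J I" using assms by (metis finite_same_card_bij)
  then have "bij_betw (restrict f J) J I" by (metis bij_betw_restrict_eq)
  then have "restrict f J \<in> bijections J I"
    by (auto simp: bijections_def bij_betw_apply)
  then show ?thesis using simI[OF assms(1,2)] by blast
qed

text \<open>The axioms for \<open>Star\<close> concern disjoint ground sets; this supplies the
  disjoint copies. An interval of naturals beyond \<open>F\<close> serves as the new ground
  set.\<close>

lemma sim_relabel_disjoint:
  assumes "finite I" "a \<in> Ob h I" "finite F"
  obtains J b where "((I, a), (J, b)) \<in> sim h" "F \<inter> J = {}"
proof -
  obtain n where n: "F \<subseteq> {..<n}" using assms(3) finite_nat_iff_bounded by blast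
  obtain b where "((I, a), ({n..<n + card I}, b)) \<in> sim h"
    using sim_relabel[OF assms(1,2), of "{n..<n + card I}"] by auto
  moreover have "F \<inter> {n..<n + card I} = {}" using n by auto
  ultimately show ?thesis using that by blast
qed

lemma std_objects_closed: "(I, a) \<in> std_objects h \<Longrightarrow> finite I \<and> a \<in> Ob h I"
  by (auto simp: std_objects_def)

lemma sim_std_object:
  assumes "finite I" "a \<in> Ob h I"
  shows "\<exists>J b. (J, b) \<in> std_objects h \<and> ((I, a), (J, b)) \<in> sim h"
proof -
  obtain b where b: "((I, a), ({1..card I}, b)) \<in> sim h"
    using sim_relabel[OF assms, of "{1..card I}"] by auto
  moreover from b have "b \<in> Ob h {1..card I}" by (auto elim: simE)
  ultimately show ?thesis by (auto simp: std_objects_def)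
qed

lemma cls_eq_iff:
  assumes "finite I" "a \<in> Ob h I" "finite J" "b \<in> Ob h J"
  shows "cls I a = cls J b \<longleftrightarrow> ((I, a), (J, b)) \<in> sim h"
proof
  assume eq: "cls I a = cls J b"
  obtain K c where "(K, c) \<in> std_objects h" "((I, a), (K, c)) \<in> sim h"
    using sim_std_object[OF assms(1,2)] by blast
  moreover from this have "((J, b), (K, c)) \<in> sim h"
    using eq by (auto simp: coinv_class_def)
  ultimately show "((I, a), (J, b)) \<in> sim h" using sim_sym sim_trans by blast
next
  assume "((I, a), (J, b)) \<in> sim h"
  then show "cls I a = cls J b"
    unfolding coinv_class_def using sim_sym sim_trans by (metis (no_types, lifting) surj_pair)
qed

lemma cls_eqI: "((I, a), (J, b)) \<in> sim h \<Longrightarrow> cls I a = cls J b"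
  by (subst cls_eq_iff) (auto elim: simE)

text \<open>Coinvariants are classes of standard objects, but by relabeling every finite labelled
  object represents one. Later proofs can thus choose the ground sets that suit them.\<close>

lemma coinvariants_eq: "coinvariants h = {cls I a | I a. finite I \<and> a \<in> Ob h I}"
proof
  show "coinvariants h \<subseteq> {cls I a | I a. finite I \<and> a \<in> Ob h I}"
  proof
    fix \<gamma> assume "\<gamma> \<in> coinvariants h"
    then obtain x where x: "x \<in> std_objects h" "\<gamma> = Restr (sim h) (std_objects h) `` {x}"
      unfolding coinvariants_def by (auto elim: quotientE)
    obtain I a where "x = (I, a)" by (cases x)
    then have "\<gamma> = cls I a" using x by (auto simp: coinv_class_def)
    then show "\<gamma> \<in> {cls I a | I a. finite I \<and> a \<in> Ob h I}"
      using x(1) \<open>x = (I, a)\<close> std_objects_closed by blast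
  qed
  show "{cls I a | I a. finite I \<and> a \<in> Ob h I} \<subseteq> coinvariants h"
  proof clarify
    fix I a assume I: "finite I" "a \<in> Ob h I"
    obtain J b where J: "(J, b) \<in> std_objects h" "((I, a), (J, b)) \<in> sim h"
      using sim_std_object[OF I] by blast
    then have "cls I a = Restr (sim h) (std_objects h) `` {(J, b)}"
      using cls_eqI[OF J(2)] by (auto simp: coinv_class_def)
    then show "cls I a \<in> coinvariants h"
      unfolding coinvariants_def using J(1) by (auto intro: quotientI)
  qed
qed

lemma cls_closed: "\<lbrakk>finite I; a \<in> Ob h I\<rbrakk> \<Longrightarrow> cls I a \<in> coinvariants h"
  unfolding coinvariants_eq by blast

lemma cls_restr_closed: "\<lbrakk>finite I; a \<in> Ob h I; J \<subseteq> I\<rbrakk> \<Longrightarrow> cls J (restr h I J a) \<in> coinvariants h"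
  by (meson cls_closed restr_closed finite_subset)

lemma coinvariantsE:
  assumes "\<gamma> \<in> coinvariants h"
  obtains I a where "finite I" "a \<in> Ob h I" "\<gamma> = cls I a"
  using assms unfolding coinvariants_eq by blast

lemma mem_cls:
  assumes "finite I" "a \<in> Ob h I" "(J, b) \<in> cls I a"
  shows "((I, a), (J, b)) \<in> sim h" "finite J" "b \<in> Ob h J" "cls J b = cls I a"
proof -
  show sim: "((I, a), (J, b)) \<in> sim h" using assms by (auto simp: coinv_class_def)
  then show "finite J" "b \<in> Ob h J" by (auto elim: simE)
  show "cls J b = cls I a" using cls_eqI[OF sim] by simp
qed

text \<open>Pattern functions and cover counts are evaluated at representatives picked by
  \<open>SOME\<close>; this turns such a pick into an ordinary labelled object of the class.\<close>

lemma coinvariants_repE: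
  assumes "\<gamma> \<in> coinvariants h"
  obtains I a where "(SOME x. x \<in> \<gamma>) = (I, a)" "finite I" "a \<in> Ob h I" "\<gamma> = cls I a"
proof -
  obtain J b where J: "finite J" "b \<in> Ob h J" "\<gamma> = cls J b"
    using assms by (rule coinvariantsE)
  then have "\<exists>x. x \<in> \<gamma>"
    using sim_std_object[OF J(1,2)] by (auto simp: coinv_class_def)
  then have "(SOME x. x \<in> \<gamma>) \<in> \<gamma>" by (rule someI_ex)
  moreover obtain I a where Ia: "(SOME x. x \<in> \<gamma>) = (I, a)" by (cases "SOME x. x \<in> \<gamma>")
  ultimately show ?thesis
    using that[OF Ia] mem_cls[OF J(1,2), of I a] J(3) by simp
qed

lemma sim_subsets:
  assumes "((I, a), (J, b)) \<in> sim h"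
  obtains f where "bij_betw f J I"
    "\<forall>L. L \<subseteq> J \<longrightarrow> cls (f ` L) (restr h I (f ` L) a) = cls L (restr h J L b)"
  using assms
proof (rule simE)
  fix f
  assume f: "f \<in> bijections J I" "b = Pull h J I f a" and I: "finite I" "a \<in> Ob h I"
  show thesis
  proof (rule that[of f])
    show "bij_betw f J I" using f by (simp add: bijections_def)
    show "\<forall>L. L \<subseteq> J \<longrightarrow> cls (f ` L) (restr h I (f ` L) a) = cls L (restr h J L b)"
      unfolding f(2) using sim_restr[OF I f(1)] cls_eqI by blast
  qed
qed

text \<open>The relabeling to the picked representative matches the subsets of type
  \<open>\<gamma>\<close> on both sides, so the count can be made on any representative.\<close>

lemma pattern_fun_cls:
  assumes "\<gamma> \<in> coinvariants h" "finite I" "b \<in> Ob h I"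
  shows "pattern_fun h \<gamma> (cls I b) = of_nat (card {J. J \<subseteq> I \<and> cls J (restr h I J b) = \<gamma>})"
proof -
  obtain K c where K: "(SOME x. x \<in> \<gamma>) = (K, c)" "finite K" "c \<in> Ob h K" "\<gamma> = cls K c"
    using assms(1) by (rule coinvariants_repE)
  obtain I' b' where I': "(SOME x. x \<in> cls I b) = (I', b')" "finite I'" "b' \<in> Ob h I'"
      "cls I b = cls I' b'"
    using cls_closed[OF assms(2,3)] by (rule coinvariants_repE)
  have "((I, b), (I', b')) \<in> sim h" using cls_eq_iff assms(2,3) I' by blast
  then obtain f where f: "bij_betw f I' I"
      "\<forall>L. L \<subseteq> I' \<longrightarrow> cls (f ` L) (restr h I (f ` L) b) = cls L (restr h I' L b')"
    by (rule sim_subsets)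
  have "{J. J \<subseteq> I' \<and> ((J, restr h I' J b'), (K, c)) \<in> sim h} =
      {J. J \<subseteq> I' \<and> cls J (restr h I' J b') = \<gamma>}"
    using K I' by (auto simp: cls_eq_iff[symmetric] restr_closed finite_subset)
  moreover have "card \<dots> = card {J. J \<subseteq> I \<and> cls J (restr h I J b) = \<gamma>}"
  proof (rule bij_betw_same_card)
    have "bij_betw ((`) f) (Pow I') (Pow I)" using f(1) by (rule bij_betw_Pow)
    then have "bij_betw ((`) f) {J \<in> Pow I'. cls J (restr h I' J b') = \<gamma>}
        {J \<in> Pow I. cls J (restr h I J b) = \<gamma>}"
      by (rule bij_betw_Collect) (simp add: f(2))
    then show "bij_betw ((`) f) {J. J \<subseteq> I' \<and> cls J (restr h I' J b') = \<gamma>}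
        {J. J \<subseteq> I \<and> cls J (restr h I J b) = \<gamma>}" by (simp add: Pow_def)
  qed
  ultimately show ?thesis
    using assms cls_closed K(1) I'(1) by (simp add: pattern_fun_def pattern_count_def)
qed

section \<open>Sizes of coinvariants\<close>

definition csize :: "(nat set \<times> 'a) set \<Rightarrow> nat" where
  "csize \<gamma> = card (fst (SOME x. x \<in> \<gamma>))"

lemma csize_cls:
  assumes "finite I" "a \<in> Ob h I"
  shows "csize (cls I a) = card I"
proof -
  obtain J b where "(SOME x. x \<in> cls I a) = (J, b)" "finite J" "b \<in> Ob h J" "cls I a = cls J b"
    using cls_closed[OF assms] by (rule coinvariants_repE)
  then show ?thesis using assms sim_card by (metis cls_eq_iff csize_def fst_conv)
qed

text \<open>Each such coinvariant has a representative on some \<open>{1..k}\<close> with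
  \<open>k \<le> n\<close>, and each \<open>Ob h {1..k}\<close> is finite. This makes the expansion
  of a product finite.\<close>

lemma finite_coinvariants_csize: "finite {\<gamma> \<in> coinvariants h. csize \<gamma> \<le> n}"
proof (rule finite_subset)
  show "{\<gamma> \<in> coinvariants h. csize \<gamma> \<le> n} \<subseteq> (\<Union>k\<in>{..n}. cls {1..k} ` Ob h {1..k})"
  proof clarify
    fix \<gamma> assume "\<gamma> \<in> coinvariants h" and n: "csize \<gamma> \<le> n"
    then obtain I a where I: "finite I" "a \<in> Ob h I" "\<gamma> = cls I a" by (metis coinvariantsE)
    then obtain J b where J: "(J, b) \<in> std_objects h" "((I, a), (J, b)) \<in> sim h"
      using sim_std_object by blast
    then obtain k where k: "J = {1..k}" "b \<in> Ob h {1..k}" by (auto simp: std_objects_def)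
    have "k = csize \<gamma>" using I csize_cls sim_card[OF J(2)] k by simp
    moreover have "\<gamma> = cls {1..k} b" using cls_eqI[OF J(2)] I k by simp
    ultimately show "\<gamma> \<in> (\<Union>k\<in>{..n}. cls {1..k} ` Ob h {1..k})" using n k(2) by blast
  qed
qed (simp add: finite_Ob)

end

section \<open>Products of pattern functions\<close>

context combinatorial_presheaf
begin

text \<open>Covers are lists because types are prescribed by position: equal types and repeated
  subsets are kept apart, and overlaps are allowed. The union condition puts every entry inside
  \<open>I\<close>.\<close>

definition covers :: "(nat set \<times> 'a) set list \<Rightarrow> nat set \<Rightarrow> 'a \<Rightarrow> nat set list set" where
  "covers ls I a = {As. map (\<lambda>A. cls A (restr h I A a)) As = ls \<and> \<Union>(set As) = I}"

text \<open>These numbers will be the coefficients of the pattern functions in the product of those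
  indexed by \<open>ls\<close>.\<close>

definition cover_count :: "(nat set \<times> 'a) set list \<Rightarrow> (nat set \<times> 'a) set \<Rightarrow> nat" where
  "cover_count ls \<gamma> = (case SOME x. x \<in> \<gamma> of (I, a) \<Rightarrow> card (covers ls I a))"

lemma finite_covers:
  assumes "finite I"
  shows "finite (covers ls I a)"
proof (rule finite_subset)
  show "covers ls I a \<subseteq> {As. set As \<subseteq> Pow I \<and> length As = length ls}"
    by (auto simp: covers_def)
  show "finite {As. set As \<subseteq> Pow I \<and> length As = length ls}"
    using assms by (intro finite_lists_length_eq) simp
qed

lemma card_covers_cong:
  assumes "((I, a), (J, b)) \<in> sim h"
  shows "card (covers ls I a) = card (covers ls J b)"
proof -
  obtain f where f: "bij_betw f J I"
      "\<forall>L. L \<subseteq> J \<longrightarrow> cls (f ` L) (restr h I (f ` L) a) = cls L (restr h J L b)"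
    using assms by (rule sim_subsets)
  have "bij_betw ((`) f) (Pow J) (Pow I)" using f(1) by (rule bij_betw_Pow)
  then have "bij_betw (map ((`) f)) (lists (Pow J)) (lists (Pow I))" by (rule bij_lists)
  then have "bij_betw (map ((`) f)) {As \<in> lists (Pow J). As \<in> covers ls J b}
      {As \<in> lists (Pow I). As \<in> covers ls I a}"
  proof (rule bij_betw_Collect)
    fix As assume As: "As \<in> lists (Pow J)"
    then have "map (\<lambda>A. cls A (restr h I A a)) (map ((`) f) As) = map (\<lambda>A. cls A (restr h J A b)) As"
      using f(2) by auto
    moreover have "\<Union>(set (map ((`) f) As)) = f ` \<Union>(set As)" by auto
    moreover have "f ` \<Union>(set As) = I \<longleftrightarrow> \<Union>(set As) = J"
    proof
      assume eq: "f ` \<Union>(set As) = I"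
      have sub: "\<Union>(set As) \<subseteq> J" using As by auto
      show "\<Union>(set As) = J"
        using f(1) eq inj_on_image_eq_iff[of f J "\<Union>(set As)" J] sub by (auto simp: bij_betw_def)
    qed (use f(1) in \<open>auto simp: bij_betw_def\<close>)
    ultimately show "map ((`) f) As \<in> covers ls I a \<longleftrightarrow> As \<in> covers ls J b"
      unfolding covers_def mem_Collect_eq by metis
  qed
  moreover have "{As \<in> lists (Pow K). As \<in> covers ls K c} = covers ls K c" for K c
    by (auto simp: covers_def)
  ultimately show ?thesis by (simp add: bij_betw_same_card)
qed

lemma cover_count_cls:
  assumes "finite I" "a \<in> Ob h I"
  shows "cover_count ls (cls I a) = card (covers ls I a)"
proof -
  obtain J b where J: "(SOME x. x \<in> cls I a) = (J, b)" "finite J" "b \<in> Ob h J" "cls I a = cls J b"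
    using cls_closed[OF assms] by (rule coinvariants_repE)
  then have "((I, a), (J, b)) \<in> sim h" using cls_eq_iff assms by blast
  then show ?thesis unfolding cover_count_def J(1) by (simp add: card_covers_cong)
qed

text \<open>A union has at most as many elements as its parts together, and the part in each
  position has the size of its prescribed type.\<close>

lemma covers_csize_le:
  assumes "finite I" "a \<in> Ob h I" "As \<in> covers ls I a"
  shows "card I \<le> (\<Sum>\<iota>\<leftarrow>ls. csize \<iota>)"
proof -
  have "card (\<Union>(set As)) \<le> (\<Sum>A\<leftarrow>As. card A)"
  proof (induction As)
    case (Cons A As)
    then show ?case using card_Un_le[of A "\<Union>(set As)"] by simp
  qed simp
  also have "(\<Sum>A\<leftarrow>As. card A) = (\<Sum>A\<leftarrow>As. csize (cls A (restr h I A a)))"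
  proof (rule arg_cong[of _ _ sum_list], rule map_cong[OF refl])
    fix A assume "A \<in> set As"
    then have "A \<subseteq> I" using assms(3) by (auto simp: covers_def)
    then show "card A = csize (cls A (restr h I A a))"
      using assms by (simp add: csize_cls restr_closed finite_subset)
  qed
  also have "\<dots> = (\<Sum>\<iota>\<leftarrow>ls. csize \<iota>)"
    using assms(3) by (auto simp: covers_def comp_def)
  finally show ?thesis using assms(3) by (simp add: covers_def)
qed

definition cover_support :: "(nat set \<times> 'a) set list \<Rightarrow> (nat set \<times> 'a) set set" where
  "cover_support ls = {\<gamma> \<in> coinvariants h. cover_count ls \<gamma> \<noteq> 0}"

lemma finite_cover_support: "finite (cover_support ls)"
proof (rule finite_subset[OF _ finite_coinvariants_csize])
  show "cover_support ls \<subseteq> {\<gamma> \<in> coinvariants h. csize \<gamma> \<le> (\<Sum>\<iota>\<leftarrow>ls. csize \<iota>)}"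
  proof clarify
    fix \<gamma> assume \<gamma>: "\<gamma> \<in> cover_support ls"
    then obtain I a where I: "finite I" "a \<in> Ob h I" "\<gamma> = cls I a"
      by (auto simp: cover_support_def elim: coinvariantsE)
    then have "covers ls I a \<noteq> {}"
      using \<gamma> by (auto simp: cover_support_def cover_count_cls)
    then show "\<gamma> \<in> coinvariants h \<and> csize \<gamma> \<le> (\<Sum>\<iota>\<leftarrow>ls. csize \<iota>)"
      using I \<gamma> covers_csize_le[OF I(1,2)] by (auto simp: cover_support_def csize_cls)
  qed
qed

text \<open>A product of pattern functions counts tuples of subsets; sorting the tuples by their union
  expresses it through the pattern functions themselves.\<close>

lemma prod_pattern_fun:
  assumes "set ls \<subseteq> coinvariants h" "\<beta> \<in> coinvariants h"
  shows "(\<Prod>\<iota>\<leftarrow>ls. pattern_fun h \<iota> \<beta>) =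
    (\<Sum>\<gamma>\<in>cover_support ls. of_nat (cover_count ls \<gamma>) * pattern_fun h \<gamma> \<beta>)"
proof -
  obtain I b where I: "finite I" "b \<in> Ob h I" "\<beta> = cls I b"
    using assms(2) by (rule coinvariantsE)
  define ty where "ty A = cls A (restr h I A b)" for A
  define N where "N \<gamma> = {J \<in> Pow I. ty J = \<gamma>}" for \<gamma>
  \<comment> \<open>Lists of subsets of \<open>I\<close> with prescribed types but arbitrary union;
    the product of the pattern values counts them.\<close>
  define tuples where "tuples ls = {As. set As \<subseteq> Pow I \<and> map ty As = ls}" for ls
  have finN: "finite (N \<gamma>)" for \<gamma> using I by (simp add: N_def)
  have pat: "pattern_fun h \<gamma> \<beta> = of_nat (card (N \<gamma>))" if "\<gamma> \<in> coinvariants h" for \<gamma>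
    using pattern_fun_cls[OF that I(1,2)] I(3) by (simp add: N_def ty_def)
  have "(\<Prod>\<iota>\<leftarrow>ls. pattern_fun h \<iota> \<beta>) = of_nat (card (tuples ls))"
    using assms(1)
  proof (induction ls)
    case Nil
    have "tuples [] = {[]}" by (auto simp: tuples_def)
    then show ?case by simp
  next
    case (Cons \<iota> ls)
    have "tuples (\<iota> # ls) = (\<lambda>(A, As). A # As) ` (N \<iota> \<times> tuples ls)"
      unfolding tuples_def N_def by (auto simp: image_iff map_eq_Cons_conv) blast+
    moreover have "inj_on (\<lambda>(A, As). A # As) (N \<iota> \<times> tuples ls)"
      by (auto simp: inj_on_def)
    ultimately have "card (tuples (\<iota> # ls)) = card (N \<iota>) * card (tuples ls)"
      by (simp add: card_image card_cartesian_product)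
    then show ?case using Cons pat by simp
  qed
  \<comment> \<open>Each tuple covers the restriction of \<open>b\<close> to its own union, since
    restricting through that union does not change types.\<close>
  also have "tuples ls = (\<Union>J\<in>Pow I. covers ls J (restr h I J b))"
  proof -
    have "map (\<lambda>A. cls A (restr h J A (restr h I J b))) As = map ty As"
      if "J \<subseteq> I" "\<Union>(set As) = J" for J As
      using that I unfolding ty_def by (intro map_cong refl) (auto simp: restr_restr Union_upper)
    then have mem: "As \<in> covers ls J (restr h I J b) \<longleftrightarrow> map ty As = ls \<and> \<Union>(set As) = J"
      if "J \<subseteq> I" for J As
      using that unfolding covers_def mem_Collect_eq by metis
    show ?thesis
    proof (rule Set.set_eqI)
      fix As
      have "As \<in> tuples ls \<longleftrightarrow> map ty As = ls \<and> \<Union>(set As) \<in> Pow I"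
        unfolding tuples_def by blast
      also have "\<dots> \<longleftrightarrow> As \<in> (\<Union>J\<in>Pow I. covers ls J (restr h I J b))"
        by (auto simp: mem)
      finally show "As \<in> tuples ls \<longleftrightarrow> \<dots>" .
    qed
  qed
  also have "card \<dots> = (\<Sum>J\<in>Pow I. card (covers ls J (restr h I J b)))"
    using I by (intro card_UN_disjoint) (auto simp: finite_covers finite_subset, auto simp: covers_def)
  also have "\<dots> = (\<Sum>J\<in>Pow I. cover_count ls (ty J))"
    using I by (intro sum.cong) (auto simp: ty_def cover_count_cls restr_closed finite_subset)
  \<comment> \<open>The summand depends only on the type of \<open>J\<close>: the sum is cut down to
    types admitting a cover and then grouped by type.\<close>
  also have "\<dots> = (\<Sum>J\<in>{J \<in> Pow I. ty J \<in> cover_support ls}. cover_count ls (ty J))"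
    using I cls_restr_closed[OF I(1,2)]
    by (intro sum.mono_neutral_right) (auto simp: ty_def cover_support_def)
  also have "\<dots> = (\<Sum>\<gamma>\<in>cover_support ls.
      \<Sum>J\<in>{J \<in> {J \<in> Pow I. ty J \<in> cover_support ls}. ty J = \<gamma>}. cover_count ls (ty J))"
    using I finite_cover_support by (intro sum.group[symmetric]) auto
  also have "\<dots> = (\<Sum>\<gamma>\<in>cover_support ls. cover_count ls \<gamma> * card (N \<gamma>))"
  proof (rule sum.cong[OF refl])
    fix \<gamma> assume "\<gamma> \<in> cover_support ls"
    then have "{J \<in> {J \<in> Pow I. ty J \<in> cover_support ls}. ty J = \<gamma>} = N \<gamma>"
      by (auto simp: N_def)
    moreover have "(\<Sum>J\<in>N \<gamma>. cover_count ls (ty J)) = (\<Sum>J\<in>N \<gamma>. cover_count ls \<gamma>)"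
      by (intro sum.cong) (auto simp: N_def)
    ultimately show "(\<Sum>J\<in>{J \<in> {J \<in> Pow I. ty J \<in> cover_support ls}. ty J = \<gamma>}. cover_count ls (ty J))
        = cover_count ls \<gamma> * card (N \<gamma>)" by simp
  qed
  also have "of_nat \<dots> = (\<Sum>\<gamma>\<in>cover_support ls. of_nat (cover_count ls \<gamma>) * pattern_fun h \<gamma> \<beta>)"
    unfolding of_nat_sum of_nat_mult by (intro sum.cong) (auto simp: pat cover_support_def)
  finally show ?thesis .
qed

section \<open>Linear independence of the pattern functions\<close>

lemma pattern_fun_self:
  assumes "\<gamma> \<in> coinvariants h"
  shows "pattern_fun h \<gamma> \<gamma> = 1"
proof -
  obtain I a where I: "finite I" "a \<in> Ob h I" "\<gamma> = cls I a"
    using assms by (rule coinvariantsE)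
  have "{J. J \<subseteq> I \<and> cls J (restr h I J a) = cls I a} = {I}"
  proof
    show "{J. J \<subseteq> I \<and> cls J (restr h I J a) = cls I a} \<subseteq> {I}"
    proof
      fix J assume "J \<in> {J. J \<subseteq> I \<and> cls J (restr h I J a) = cls I a}"
      then have J: "J \<subseteq> I" "cls J (restr h I J a) = cls I a" by auto
      then have "card J = card I"
        using csize_cls[of J "restr h I J a"] csize_cls[of I a] I
        by (simp add: restr_closed finite_subset)
      then show "J \<in> {I}" using J I card_subset_eq by blast
    qed
  qed (use I in \<open>auto simp: restr_self\<close>)
  then show ?thesis using pattern_fun_cls[OF cls_closed I(1,2)] I by simp
qed

text \<open>A subset of type \<open>\<gamma>\<close> has \<open>csize \<gamma>\<close> elements. The
  size hypothesis forces it to be the whole ground set, whose type is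
  \<open>\<beta>\<close>.\<close>

lemma pattern_fun_eq_0:
  assumes "\<gamma> \<in> coinvariants h" "\<beta> \<in> coinvariants h" "csize \<beta> \<le> csize \<gamma>" "\<beta> \<noteq> \<gamma>"
  shows "pattern_fun h \<gamma> \<beta> = 0"
proof -
  obtain I b where I: "finite I" "b \<in> Ob h I" "\<beta> = cls I b"
    using assms(2) by (rule coinvariantsE)
  have "cls J (restr h I J b) \<noteq> \<gamma>" if J: "J \<subseteq> I" for J
  proof
    assume eq: "cls J (restr h I J b) = \<gamma>"
    have "finite J" using I(1) J by (rule rev_finite_subset)
    then have "csize \<gamma> = card J"
      using csize_cls[of J "restr h I J b"] restr_closed[OF I(1) J I(2)] eq by simp
    then have "card I \<le> card J" using assms(3) csize_cls[OF I(1,2)] I(3) by simp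
    then have "J = I" using I(1) J by (metis card_seteq)
    then show False using eq assms(4) I restr_self by simp
  qed
  then have "{J. J \<subseteq> I \<and> cls J (restr h I J b) = \<gamma>} = {}" by blast
  then show ?thesis
    unfolding I(3) pattern_fun_cls[OF assms(1) I(1,2)] by (simp only: card.empty of_nat_0)
qed

text \<open>Evaluate a nontrivial relation at a coinvariant \<open>\<beta>\<close> of least size
  with nonzero coefficient. All other terms vanish, and \<open>\<beta>\<close> occurs exactly once
  in itself.\<close>

lemma independent_on_pattern_fun:
  "independent_on (coinvariants h) (coinvariants h) (pattern_fun h)"
  unfolding independent_on_def
proof (intro allI impI, rule ccontr)
  fix T c
  assume T: "finite T" "T \<subseteq> coinvariants h"
    and zero: "\<forall>\<beta>\<in>coinvariants h. (\<Sum>\<gamma>\<in>T. c \<gamma> * pattern_fun h \<gamma> \<beta>) = 0"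
    and "\<not> (\<forall>\<gamma>\<in>T. c \<gamma> = 0)"
  then have "\<exists>\<beta>. \<beta> \<in> T \<and> c \<beta> \<noteq> 0" by blast
  then obtain \<beta> where \<beta>: "\<beta> \<in> T" "c \<beta> \<noteq> 0"
    and min: "\<And>\<gamma>. \<gamma> \<in> T \<Longrightarrow> c \<gamma> \<noteq> 0 \<Longrightarrow> csize \<beta> \<le> csize \<gamma>"
    using ex_has_least_nat[of "\<lambda>\<beta>. \<beta> \<in> T \<and> c \<beta> \<noteq> 0" _ csize] by blast
  have "(\<Sum>\<gamma>\<in>T. c \<gamma> * pattern_fun h \<gamma> \<beta>) = (\<Sum>\<gamma>\<in>{\<beta>}. c \<gamma> * pattern_fun h \<gamma> \<beta>)"
  proof (intro sum.mono_neutral_right ballI)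
    fix \<gamma> assume \<gamma>: "\<gamma> \<in> T - {\<beta>}"
    show "c \<gamma> * pattern_fun h \<gamma> \<beta> = 0"
    proof (cases "c \<gamma> = 0")
      case False
      then have "pattern_fun h \<gamma> \<beta> = 0"
        using min[of \<gamma>] \<gamma> \<beta> T by (intro pattern_fun_eq_0) auto
      then show ?thesis by simp
    qed simp
  qed (use T \<beta> in auto)
  then show False using zero \<beta> T pattern_fun_self by auto
qed

section \<open>The span of the pattern functions as an algebra\<close>

abbreviation pattern_carrier :: "((nat set \<times> 'a) set \<Rightarrow> rat) set" where
  "pattern_carrier \<equiv> {f \<in> coinvariants h \<rightarrow>\<^sub>E UNIV.
     lincomb_on (coinvariants h) (coinvariants h) (pattern_fun h) f}"

lemma pattern_algebra_eq:
  "pattern_algebra h = function_algebra (coinvariants h) \<lparr>carrier := pattern_carrier\<rparr>"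
proof -
  have "{(\<lambda>\<beta>\<in>coinvariants h. \<Sum>\<alpha>\<in>S. c \<alpha> * pattern_fun h \<alpha> \<beta>) | S c.
      finite S \<and> S \<subseteq> coinvariants h} = pattern_carrier" (is "?L = ?R")
  proof
    show "?L \<subseteq> ?R"
    proof
      fix f assume "f \<in> ?L"
      then obtain S c where S: "finite S" "S \<subseteq> coinvariants h"
          "f = (\<lambda>\<beta>\<in>coinvariants h. \<Sum>\<alpha>\<in>S. c \<alpha> * pattern_fun h \<alpha> \<beta>)" by blast
      then have "lincomb_on (coinvariants h) (coinvariants h) (pattern_fun h) f"
        unfolding lincomb_on_def by (intro exI[of _ S] exI[of _ c]) simp
      then show "f \<in> ?R" using S(3) by simp
    qed
    show "?R \<subseteq> ?L"
    proof
      fix f assume f: "f \<in> ?R"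
      then obtain T c where T: "finite T" "T \<subseteq> coinvariants h"
          "\<forall>\<beta>\<in>coinvariants h. f \<beta> = (\<Sum>\<alpha>\<in>T. c \<alpha> * pattern_fun h \<alpha> \<beta>)"
        unfolding lincomb_on_def by blast
      have "f = (\<lambda>\<beta>\<in>coinvariants h. f \<beta>)" using f by (auto simp: PiE_def extensional_restrict)
      also have "\<dots> = (\<lambda>\<beta>\<in>coinvariants h. \<Sum>\<alpha>\<in>T. c \<alpha> * pattern_fun h \<alpha> \<beta>)"
        using T(3) by (intro restrict_ext) simp
      finally show "f \<in> ?L" using T(1,2) by blast
    qed
  qed
  then show ?thesis by (simp add: pattern_algebra_def)
qed

text \<open>Closure under products is \<open>prod_pattern_fun\<close> for lists of length two,
  extended bilinearly; the same expansion for the empty list puts the constant 1 into the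
  span.\<close>

lemma algebra_pattern_algebra: "algebra rat_field (pattern_algebra h)"
  unfolding pattern_algebra_eq
proof (rule algebra_function_algebra_restrict_carrier)
  let ?G = "coinvariants h" and ?p = "pattern_fun h"
  note cong = lincomb_on_cong[where Y = ?G]
  have prod: "lincomb_on ?G ?G ?p (\<lambda>\<beta>. \<Prod>\<iota>\<leftarrow>ls. ?p \<iota> \<beta>)" if "set ls \<subseteq> ?G" for ls
  proof (rule cong)
    show "lincomb_on ?G ?G ?p (\<lambda>\<beta>. \<Sum>\<gamma>\<in>cover_support ls. of_nat (cover_count ls \<gamma>) * ?p \<gamma> \<beta>)"
      by (intro lincomb_on_sum lincomb_on_smult lincomb_on_base) (simp add: cover_support_def)
  qed (rule prod_pattern_fun[OF that])
  show "pattern_carrier \<subseteq> ?G \<rightarrow>\<^sub>E UNIV" by blast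
  have "lincomb_on ?G ?G ?p (\<lambda>\<beta>\<in>?G. 1)" by (rule cong[OF prod[of "[]"]]) auto
  then show "(\<lambda>\<beta>\<in>?G. 1) \<in> pattern_carrier" by auto
  fix f g assume f: "f \<in> pattern_carrier" and g: "g \<in> pattern_carrier"
  have "lincomb_on ?G ?G ?p (\<lambda>\<beta>\<in>?G. f \<beta> + g \<beta>)"
    by (rule cong[OF lincomb_on_add[of _ _ _ f g]]) (use f g in auto)
  then show "(\<lambda>\<beta>\<in>?G. f \<beta> + g \<beta>) \<in> pattern_carrier" by auto
  obtain T c where T: "T \<subseteq> ?G" "\<And>\<beta>. \<beta> \<in> ?G \<Longrightarrow> f \<beta> = (\<Sum>\<alpha>\<in>T. c \<alpha> * ?p \<alpha> \<beta>)"
    using f unfolding lincomb_on_def by blast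
  obtain U d where U: "U \<subseteq> ?G" "\<And>\<beta>. \<beta> \<in> ?G \<Longrightarrow> g \<beta> = (\<Sum>\<alpha>\<in>U. d \<alpha> * ?p \<alpha> \<beta>)"
    using g unfolding lincomb_on_def by blast
  have "lincomb_on ?G ?G ?p (\<lambda>\<beta>. \<Sum>\<alpha>\<in>T. \<Sum>\<gamma>\<in>U. (c \<alpha> * d \<gamma>) * (\<Prod>\<iota>\<leftarrow>[\<alpha>, \<gamma>]. ?p \<iota> \<beta>))"
    using T(1) U(1) by (intro lincomb_on_sum lincomb_on_smult prod) auto
  then have "lincomb_on ?G ?G ?p (\<lambda>\<beta>\<in>?G. f \<beta> * g \<beta>)"
    by (rule cong) (simp add: T(2) U(2) sum_product mult_ac)
  then show "(\<lambda>\<beta>\<in>?G. f \<beta> * g \<beta>) \<in> pattern_carrier" by auto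
next
  fix a f assume f: "f \<in> pattern_carrier"
  have "lincomb_on (coinvariants h) (coinvariants h) (pattern_fun h) (\<lambda>\<beta>\<in>coinvariants h. a * f \<beta>)"
    by (rule lincomb_on_cong[OF lincomb_on_smult[of _ _ _ f a]]) (use f in auto)
  then show "(\<lambda>\<beta>\<in>coinvariants h. a * f \<beta>) \<in> pattern_carrier" by auto
qed

end

section \<open>Unique factorization\<close>

text \<open>An ordering of the image multiset lifts to the original one. This will order the blocks
  of a factorization by a given list of types.\<close>

lemma image_mset_eq_mset_map:
  assumes "image_mset f M = mset ys"
  obtains xs where "mset xs = M" "map f xs = ys"
  using assms
proof (induction ys arbitrary: M thesis)
  case (Cons y ys)
  obtain N x where N: "M = add_mset x N" "f x = y" "image_mset f N = mset ys"
    using Cons.prems(2) by (auto dest: msed_map_invR)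
  obtain xs where "mset xs = N" "map f xs = ys" using Cons.IH N(3) by blast
  then show ?case using Cons.prems(1)[of "x # xs"] N by simp
qed simp

text \<open>Monomials are multisets while covers are indexed by lists, so each monomial gets an
  arbitrary ordering.\<close>

definition some_list :: "'b multiset \<Rightarrow> 'b list" where
  "some_list m = (SOME xs. mset xs = m)"

lemma mset_some_list [simp]: "mset (some_list m) = m"
  unfolding some_list_def using ex_mset by (rule someI_ex)

section \<open>Products of labelled objects on disjoint ground sets\<close>

context associative_presheaf
begin

text \<open>Disjointness on both sides lets the two relabelings glue to one of the unions, and
  naturality of \<open>Star\<close> identifies the products. Hence products are well defined on
  classes.\<close>

lemma sim_Star:
  assumes "((I, a), (I', a')) \<in> sim h" "((J, b), (J', b')) \<in> sim h" "I \<inter> J = {}" "I' \<inter> J' = {}"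
  shows "((I \<union> J, Star h I J a b), (I' \<union> J', Star h I' J' a' b')) \<in> sim h"
proof -
  obtain f where f: "f \<in> bijections I' I" "a' = Pull h I' I f a" "finite I" "a \<in> Ob h I"
    using assms(1) by (rule simE)
  obtain g where g: "g \<in> bijections J' J" "b' = Pull h J' J g b" "finite J" "b \<in> Ob h J"
    using assms(2) by (rule simE)
  let ?k = "\<lambda>x\<in>I' \<union> J'. if x \<in> I' then f x else g x"
  have "bij_betw ?k I' I"
    by (rule bij_betw_cong[THEN iffD1, of _ f]) (use f in \<open>auto simp: bijections_def\<close>)
  moreover have "bij_betw ?k J' J"
    by (rule bij_betw_cong[THEN iffD1, of _ g])
      (use g assms(4) in \<open>auto simp: bijections_def disjoint_iff\<close>)
  ultimately have "bij_betw ?k (I' \<union> J') (I \<union> J)"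
    using assms(3) by (rule bij_betw_combine)
  moreover have "f x \<in> I" if "x \<in> I'" for x using that f(1) by (auto simp: bijections_def)
  moreover have "g x \<in> J" if "x \<in> J'" for x using that g(1) by (auto simp: bijections_def)
  ultimately have k: "?k \<in> bijections (I' \<union> J') (I \<union> J)"
    by (auto simp: bijections_def)
  then show ?thesis
    using f g assms(3,4) Star_natural Star_closed by (intro simI[OF _ _ k]) simp_all
qed

text \<open>As \<open>Ob h {}\<close> is a singleton, \<open>b\<close> restricts to the unit on the
  empty set, so restricting factor by factor leaves \<open>a\<close> times the unit.\<close>

lemma Star_restr_left:
  assumes "finite I" "finite J" "I \<inter> J = {}" "a \<in> Ob h I" "b \<in> Ob h J" "Ob h {} = {Unit h}"
  shows "restr h (I \<union> J) I (Star h I J a b) = a"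
proof -
  have "restr h J {} b = Unit h" using restr_closed[of J "{}" b] assms by simp
  then show ?thesis
    using Star_restr[of I J I "{}" a b] assms by (simp add: restr_self Star_Unit_right)
qed

lemma Star_restr_right:
  assumes "finite I" "finite J" "I \<inter> J = {}" "a \<in> Ob h I" "b \<in> Ob h J" "Ob h {} = {Unit h}"
  shows "restr h (I \<union> J) J (Star h I J a b) = b"
proof -
  have "restr h I {} a = Unit h" using restr_closed[of I "{}" a] assms by simp
  then show ?thesis
    using Star_restr[of I J "{}" J a b] assms by (simp add: restr_self Star_Unit_left)
qed

end

locale connected_commutative_presheaf = commutative_presheaf h
  for h :: "('a, 'm) monoid_presheaf_scheme" +
  assumes connected: "connected_presheaf h"
begin

lemma Ob_empty: "Ob h {} = {Unit h}"
  using connected Unit_closed by (auto simp: connected_presheaf_def card_1_singleton_iff)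

section \<open>Splitting sets under restriction and relabeling\<close>

definition splits :: "nat set \<Rightarrow> nat set \<Rightarrow> 'a \<Rightarrow> bool" where
  "splits I A c \<longleftrightarrow> A \<subseteq> I \<and> c = Star h A (I - A) (restr h I A c) (restr h I (I - A) c)"

definition indecomposable :: "nat set \<Rightarrow> 'a \<Rightarrow> bool" where
  "indecomposable I c \<longleftrightarrow> I \<noteq> {} \<and> (\<forall>A. splits I A c \<longrightarrow> A = {} \<or> A = I)"

text \<open>Requiring each block to split \<open>c\<close> by itself replaces an iterated product,
  so no order or bracketing of the blocks has to be chosen. Blocks may be empty here;
  indecomposability excludes this in factorizations.\<close>

definition decomposition :: "nat set set \<Rightarrow> nat set \<Rightarrow> 'a \<Rightarrow> bool" where
  "decomposition P I c \<longleftrightarrow> pairwise disjnt P \<and> \<Union>P = I \<and> (\<forall>B\<in>P. splits I B c)"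

definition factorization :: "nat set set \<Rightarrow> nat set \<Rightarrow> 'a \<Rightarrow> bool" where
  "factorization P I c \<longleftrightarrow>
     decomposition P I c \<and> (\<forall>B\<in>P. indecomposable B (restr h I B c))"

definition block_classes :: "nat set set \<Rightarrow> nat set \<Rightarrow> 'a \<Rightarrow> (nat set \<times> 'a) set multiset" where
  "block_classes P I c = image_mset (\<lambda>B. cls B (restr h I B c)) (mset_set P)"

lemma splits_self: "\<lbrakk>finite I; c \<in> Ob h I\<rbrakk> \<Longrightarrow> splits I I c"
  using restr_closed[of I "{}" c] by (simp add: splits_def restr_self Ob_empty Star_Unit_right)

lemma splits_compl:
  assumes "finite I" "c \<in> Ob h I" "splits I A c"
  shows "splits I (I - A) c"
proof -
  have A: "A \<subseteq> I" "I - (I - A) = A" using assms(3) by (auto simp: splits_def)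
  have "Star h A (I - A) (restr h I A c) (restr h I (I - A) c) =
      Star h (I - A) A (restr h I (I - A) c) (restr h I A c)"
    using assms A by (intro Star_comm) (auto intro: restr_closed finite_subset)
  then show ?thesis using assms(3) A unfolding splits_def by simp
qed

text \<open>\<open>Star\<close> restricts factor by factor, so the product over \<open>A\<close> and
  \<open>I - A\<close> becomes one over \<open>A \<inter> J\<close> and its complement in
  \<open>J\<close>.\<close>

lemma splits_restr:
  assumes "finite I" "c \<in> Ob h I" "splits I A c" "J \<subseteq> I"
  shows "splits J (A \<inter> J) (restr h I J c)"
proof -
  have A: "A \<subseteq> I" and c: "c = Star h A (I - A) (restr h I A c) (restr h I (I - A) c)"
    using assms(3) by (simp_all add: splits_def)
  have eq: "A \<union> (I - A) = I" "A \<inter> J \<union> (I - A) \<inter> J = J" "J - A \<inter> J = (I - A) \<inter> J"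
    using A assms(4) by auto
  have "restr h I J c = restr h (A \<union> (I - A)) (A \<inter> J \<union> (I - A) \<inter> J)
      (Star h A (I - A) (restr h I A c) (restr h I (I - A) c))"
    unfolding eq by (rule arg_cong[OF c])
  also have "\<dots> = Star h (A \<inter> J) ((I - A) \<inter> J) (restr h A (A \<inter> J) (restr h I A c))
      (restr h (I - A) ((I - A) \<inter> J) (restr h I (I - A) c))"
    using assms A by (intro Star_restr) (auto intro: restr_closed finite_subset)
  also have "\<dots> = Star h (A \<inter> J) (J - A \<inter> J) (restr h J (A \<inter> J) (restr h I J c))
      (restr h J (J - A \<inter> J) (restr h I J c))"
    using assms A by (simp add: restr_restr eq)
  finally show ?thesis by (simp add: splits_def)
qed

text \<open>Split \<open>A\<close> into \<open>B\<close> and \<open>A - B\<close> and reassociate.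
  The product over \<open>A - B\<close> and \<open>I - A\<close> is the restriction of
  \<open>c\<close> to \<open>I - B\<close>, by \<open>splits_restr\<close> for \<open>A\<close> on
  \<open>I - B\<close>.\<close>

lemma splits_trans:
  assumes "finite I" "c \<in> Ob h I" "splits I A c" "splits A B (restr h I A c)"
  shows "splits I B c"
proof -
  have sub: "A \<subseteq> I" "B \<subseteq> A" using assms(3,4) by (auto simp: splits_def)
  have eq: "(A - B) \<union> (I - A) = I - B" "A \<inter> (I - B) = A - B" "I - B - (A - B) = I - A"
    "B \<union> (A - B) = A"
    using sub by auto
  have fin: "finite A" "finite B" using sub assms(1) by (auto intro: finite_subset)
  have "c = Star h A (I - A) (restr h I A c) (restr h I (I - A) c)"
    using assms(3) by (simp add: splits_def)
  also have "restr h I A c = Star h B (A - B) (restr h I B c) (restr h I (A - B) c)"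
    using assms sub unfolding splits_def by (metis Diff_subset restr_restr)
  also have "Star h A (I - A) \<dots> (restr h I (I - A) c) =
      Star h B (I - B) (restr h I B c) (Star h (A - B) (I - A) (restr h I (A - B) c) (restr h I (I - A) c))"
  proof (rule Star_assoc[of B "A - B" "I - A", unfolded eq])
    show "restr h I B c \<in> Ob h B" "restr h I (A - B) c \<in> Ob h (A - B)"
      "restr h I (I - A) c \<in> Ob h (I - A)"
      using assms(1,2) sub by (auto intro!: restr_closed)
  qed (use assms(1) fin sub in auto)
  also have "Star h (A - B) (I - A) (restr h I (A - B) c) (restr h I (I - A) c) = restr h I (I - B) c"
  proof -
    have "A - B \<subseteq> I - B" "I - A \<subseteq> I - B" using sub by auto
    then show ?thesis
      using splits_restr[OF assms(1-3), of "I - B"] restr_restr[OF assms(1,2), of "I - B"]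
      by (simp add: splits_def eq)
  qed
  finally show ?thesis using sub by (simp add: splits_def)
qed

lemma splits_Star:
  assumes "finite I" "finite J" "I \<inter> J = {}" "a \<in> Ob h I" "b \<in> Ob h J"
  shows "splits (I \<union> J) I (Star h I J a b)"
proof -
  have "I \<union> J - I = J" using assms(3) by auto
  then show ?thesis
    using assms by (simp add: splits_def Star_restr_left Star_restr_right Ob_empty)
qed

text \<open>Naturality of \<open>Star\<close>, applied to the restrictions of \<open>f\<close> to
  \<open>A\<close> and to \<open>J - A\<close>, carries the product form of \<open>a\<close> to its
  pullback.\<close>

lemma splits_Pull:
  assumes "finite I" "a \<in> Ob h I" "f \<in> bijections J I" "A \<subseteq> J" "splits I (f ` A) a"
  shows "splits J A (Pull h J I f a)"
proof -
  have bij: "inj_on f J" "f ` J = I" and ext: "f \<in> extensional J"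
    using assms(3) by (auto simp: bijections_def bij_betw_def PiE_def)
  have sub: "f ` A \<subseteq> I" using assms(4) bij by auto
  have compl: "I - f ` A = f ` (J - A)"
    using bij assms(4) by (simp add: inj_on_image_set_diff)
  have res: "restrict f L \<in> bijections L (f ` L)" if "L \<subseteq> J" for L
    using bij(1) that by (auto simp: bijections_def bij_betw_def intro: inj_on_subset)
  \<comment> \<open>Gluing the two restrictions gives back \<open>f\<close> as a function, including
    its default value outside \<open>J\<close>.\<close>
  have "(\<lambda>x\<in>A \<union> (J - A). if x \<in> A then restrict f A x else restrict f (J - A) x) = f"
    using assms(4) ext by (auto simp: fun_eq_iff extensional_def)
  moreover have "A \<union> (J - A) = J" "f ` A \<union> f ` (J - A) = I" "f ` A \<inter> f ` (J - A) = {}"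
    using assms(4) bij compl by auto
  moreover have "Pull h (A \<union> (J - A)) (f ` A \<union> f ` (J - A))
      (\<lambda>x\<in>A \<union> (J - A). if x \<in> A then restrict f A x else restrict f (J - A) x)
      (Star h (f ` A) (f ` (J - A)) (restr h I (f ` A) a) (restr h I (f ` (J - A)) a)) =
    Star h A (J - A) (Pull h A (f ` A) (restrict f A) (restr h I (f ` A) a))
      (Pull h (J - A) (f ` (J - A)) (restrict f (J - A)) (restr h I (f ` (J - A)) a))"
    using assms(1,2,4) sub compl[symmetric]
    by (intro Star_natural res) (auto intro: finite_subset restr_closed)
  moreover have "Star h (f ` A) (f ` (J - A)) (restr h I (f ` A) a) (restr h I (f ` (J - A)) a) = a"
    using assms(5) compl by (simp add: splits_def)
  ultimately show ?thesis
    using assms(4) restr_Pull[OF assms(1,2) bijections_into_injections[OF assms(3)]]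
    by (simp add: splits_def)
qed

lemma splits_Pull_iff:
  assumes "finite I" "a \<in> Ob h I" "f \<in> bijections J I" "A \<subseteq> J"
  shows "splits J A (Pull h J I f a) \<longleftrightarrow> splits I (f ` A) a"
proof
  assume J: "splits J A (Pull h J I f a)"
  obtain g where g: "g \<in> bijections I J" "a = Pull h I J g (Pull h J I f a)"
      "\<forall>x\<in>J. g (f x) = x"
    using assms(1-3) by (rule bijections_inverse)
  have f: "f ` A \<subseteq> I" "finite J"
    using assms by (auto simp: bijections_def dest: bij_betw_finite)
  have "g ` (f ` A) = A" using g(3) assms(4) by (force simp: image_image)
  then have "splits I (f ` A) (Pull h I J g (Pull h J I f a))"
    using J Pull_closed[OF assms(1) bijections_into_injections[OF assms(3)] assms(2)]
    by (intro splits_Pull[OF f(2) _ g(1) f(1)]) simp_all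
  then show "splits I (f ` A) a" by (simp only: g(2)[symmetric])
qed (use splits_Pull assms in blast)

lemma indecomposable_sim:
  assumes "((I, a), (J, b)) \<in> sim h" "indecomposable J b"
  shows "indecomposable I a"
proof -
  obtain f where f: "f \<in> bijections J I" "b = Pull h J I f a" and I: "finite I" "a \<in> Ob h I"
    using assms(1) by (rule simE)
  have im: "f ` J = I" using f by (auto simp: bijections_def bij_betw_def)
  have "A = {} \<or> A = I" if A: "splits I A a" for A
  proof -
    have "A \<subseteq> f ` J" using A im by (simp add: splits_def)
    then obtain L where L: "L \<subseteq> J" "A = f ` L" by (auto simp: subset_image_iff)
    then have "splits J L b" using A splits_Pull_iff[OF I f(1) L(1)] f(2) by simp
    then show ?thesis using assms(2) L im by (auto simp: indecomposable_def)
  qed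
  then show ?thesis using assms(2) im by (auto simp: indecomposable_def)
qed

section \<open>Existence and uniqueness of factorizations into indecomposables\<close>

lemma decomposition_finite: "\<lbrakk>finite I; decomposition P I c\<rbrakk> \<Longrightarrow> finite P"
  by (auto simp: decomposition_def intro: finite_UnionD)

text \<open>The inductive step for decompositions: the other blocks lie in \<open>I - B\<close>, and
  by \<open>splits_restr\<close> they still split the restriction to it.\<close>

lemma decomposition_remove:
  assumes "finite I" "c \<in> Ob h I" "decomposition P I c" "B \<in> P"
  shows "decomposition (P - {B}) (I - B) (restr h I (I - B) c)"
    and "block_classes P I c =
      add_mset (cls B (restr h I B c)) (block_classes (P - {B}) (I - B) (restr h I (I - B) c))"
proof -
  have P: "pairwise disjnt P" "\<Union>P = I" "\<And>D. D \<in> P \<Longrightarrow> splits I D c"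
    using assms(3) by (auto simp: decomposition_def)
  have D: "D \<subseteq> I - B" if "D \<in> P - {B}" for D
    using that P(1,2) assms(4) by (auto simp: pairwise_def disjnt_def)
  have "\<Union>(P - {B}) = I - B" using D P(2) by auto
  moreover have "splits (I - B) D (restr h I (I - B) c)" if "D \<in> P - {B}" for D
    using splits_restr[OF assms(1,2) P(3), of D "I - B"] D[OF that] that
    by (simp add: Int_absorb2)
  ultimately show "decomposition (P - {B}) (I - B) (restr h I (I - B) c)"
    using P(1) by (auto simp: decomposition_def pairwise_def)
  have "finite P" using assms(1,3) by (rule decomposition_finite)
  then show "block_classes P I c =
      add_mset (cls B (restr h I B c)) (block_classes (P - {B}) (I - B) (restr h I (I - B) c))"
    using assms D by (auto simp: block_classes_def mset_set.remove restr_restr intro!: image_mset_cong)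
qed

text \<open>An object is rebuilt from the types of its blocks, by induction on their number. Equal
  multisets match a block \<open>B\<close> with a block \<open>B'\<close> of the same type; the
  complements are related by induction, and \<open>sim_Star\<close> glues the parts back to
  \<open>c\<close> and \<open>c'\<close> because both blocks split.\<close>

lemma sim_of_block_classes:
  assumes "finite I" "c \<in> Ob h I" "decomposition P I c"
    and "finite I'" "c' \<in> Ob h I'" "decomposition P' I' c'"
    and "block_classes P I c = block_classes P' I' c'"
  shows "((I, c), (I', c')) \<in> sim h"
  using decomposition_finite[OF assms(1,3)] assms
proof (induction "card P" arbitrary: P I c P' I' c')
  case 0
  have fin': "finite P'" using decomposition_finite 0 by blast
  have "P = {}" using 0 by simp
  moreover from this have "P' = {}"
    using 0 fin' by (simp add: block_classes_def mset_set_empty_iff)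
  ultimately have "I = {}" "I' = {}" using 0 by (auto simp: decomposition_def)
  then show ?case using 0 Ob_empty sim_refl[of "{}"] by simp
next
  case (Suc n)
  have fin': "finite P'" using decomposition_finite Suc.prems by blast
  obtain B where B: "B \<in> P" using Suc.hyps(2) by fastforce
  note rem = decomposition_remove[OF Suc.prems(2-4) B]
  have "cls B (restr h I B c) \<in># block_classes P' I' c'"
    using rem(2) Suc.prems(8) by (metis union_single_eq_member)
  then obtain B' where B': "B' \<in> P'" "cls B (restr h I B c) = cls B' (restr h I' B' c')"
    using fin' by (auto simp: block_classes_def)
  note rem' = decomposition_remove[OF Suc.prems(5-7) B'(1)]
  have sub: "B \<subseteq> I" "B' \<subseteq> I'" and spl: "splits I B c" "splits I' B' c'"
    using B B' Suc.prems by (auto simp: decomposition_def)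
  have simB: "((B, restr h I B c), (B', restr h I' B' c')) \<in> sim h"
    using B'(2) sub Suc.prems by (subst cls_eq_iff[symmetric]) (auto intro: finite_subset restr_closed)
  have "((I - B, restr h I (I - B) c), (I' - B', restr h I' (I' - B') c')) \<in> sim h"
  proof (rule Suc.hyps(1))
    show "n = card (P - {B})" using Suc.hyps(2) B Suc.prems(1) by simp
    show "block_classes (P - {B}) (I - B) (restr h I (I - B) c) =
        block_classes (P' - {B'}) (I' - B') (restr h I' (I' - B') c')"
      using rem(2) rem'(2) Suc.prems(8) B'(2) by simp
  qed (use rem rem' Suc.prems in \<open>auto intro: restr_closed\<close>)
  from sim_Star[OF simB this] show ?case
    using spl sub by (simp add: splits_def Un_absorb1)
qed

text \<open>Induction on the ground set: a nontrivial splitting set \<open>A\<close> leaves the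
  smaller sets \<open>A\<close> and \<open>I - A\<close>. Blocks of the two restrictions split
  \<open>c\<close> itself by \<open>splits_trans\<close> and are put together.\<close>

lemma factorization_exists:
  assumes "finite I" "c \<in> Ob h I"
  shows "\<exists>P. factorization P I c"
  using assms
proof (induction I arbitrary: c rule: finite_psubset_induct)
  case (psubset I)
  note I = psubset.hyps psubset.prems
  consider "I = {}" | "indecomposable I c" | A where "splits I A c" "A \<noteq> {}" "A \<noteq> I"
    by (auto simp: indecomposable_def)
  then show ?case
  proof cases
    case 1
    then show ?thesis
      by (intro exI[of _ "{}"]) (simp add: factorization_def decomposition_def)
  next
    case 2
    then show ?thesis
      using splits_self[OF I] restr_self[OF I]
      by (intro exI[of _ "{I}"]) (simp add: factorization_def decomposition_def)
  next
    case 3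
    have A: "A \<subset> I" "I - A \<subset> I" using 3 by (auto simp: splits_def)
    have part: "splits I B c \<and> indecomposable B (restr h I B c)"
      if "factorization P J (restr h I J c)" "B \<in> P" "splits I J c" for P J B
    proof -
      have B: "splits J B (restr h I J c)" "indecomposable B (restr h J B (restr h I J c))"
        using that(1,2) by (auto simp: factorization_def decomposition_def)
      then have "B \<subseteq> J" "J \<subseteq> I" using that(3) by (auto simp: splits_def)
      then show ?thesis using B splits_trans[OF I that(3)] restr_restr[OF I] by simp
    qed
    obtain P1 where P1: "factorization P1 A (restr h I A c)"
      using psubset.IH[OF A(1)] restr_closed[OF I(1)] I(2) A(1) by blast
    obtain P2 where P2: "factorization P2 (I - A) (restr h I (I - A) c)"
      using psubset.IH[OF A(2)] restr_closed[OF I(1)] I(2) A(2) by blast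
    have U: "\<Union>P1 = A" "\<Union>P2 = I - A" and disj: "pairwise disjnt P1" "pairwise disjnt P2"
      using P1 P2 by (auto simp: factorization_def decomposition_def)
    have "disjnt B D" if "B \<in> P1" "D \<in> P2" for B D
      using that U by (auto simp: disjnt_def)
    then have "pairwise disjnt (P1 \<union> P2)"
      using disj by (auto simp: pairwise_def disjnt_sym)
    moreover have "\<Union>(P1 \<union> P2) = I" using U A by auto
    ultimately show ?thesis
      using part[OF P1 _ 3(1)] part[OF P2 _ splits_compl[OF I 3(1)]]
      by (intro exI[of _ "P1 \<union> P2"]) (auto simp: factorization_def decomposition_def)
  qed
qed

text \<open>Every block splits the restriction to \<open>A\<close>, so an indecomposable restriction lies in
  a single block.\<close>

lemma indecomposable_within_block:
  assumes "finite I" "c \<in> Ob h I" "factorization P I c"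
    and "A \<subseteq> I" "indecomposable A (restr h I A c)"
  obtains B where "B \<in> P" "A \<subseteq> B"
proof -
  obtain x where "x \<in> A" using assms(5) by (auto simp: indecomposable_def)
  moreover from this obtain B where B: "x \<in> B" "B \<in> P"
    using assms(3,4) by (auto simp: factorization_def decomposition_def)
  moreover have "splits A (B \<inter> A) (restr h I A c)"
    using assms B by (intro splits_restr) (auto simp: factorization_def decomposition_def)
  ultimately have "B \<inter> A = A" using assms(5) by (auto simp: indecomposable_def)
  then show thesis using that B by blast
qed

lemma factorization_block_eq:
  assumes "factorization P I c" "B \<in> P" "D \<in> P" "x \<in> B" "x \<in> D"
  shows "B = D"
  using assms by (auto simp: factorization_def decomposition_def pairwise_def disjnt_def)

text \<open>A block \<open>A\<close> of one factorization lies in a block \<open>B\<close> of the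
  other, and \<open>B\<close> in a block \<open>A'\<close> of the first. Since \<open>A\<close> is
  nonempty, \<open>A = A'\<close>, and all three agree.\<close>

lemma factorization_unique:
  assumes "finite I" "c \<in> Ob h I" "factorization P I c" "factorization Q I c"
  shows "P = Q"
proof -
  have "P \<subseteq> Q" if P: "factorization P I c" and Q: "factorization Q I c" for P Q
  proof
    fix A assume A: "A \<in> P"
    have within: "\<exists>D\<in>S. B \<subseteq> D" if "B \<in> R" "factorization R I c" "factorization S I c" for B R S
    proof -
      have "B \<subseteq> I" "indecomposable B (restr h I B c)"
        using that(1,2) by (auto simp: factorization_def decomposition_def)
      then show ?thesis by (rule indecomposable_within_block[OF assms(1,2) that(3)]) blast
    qed
    obtain B where B: "B \<in> Q" "A \<subseteq> B" using within[OF A P Q] by blast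
    obtain A' where A': "A' \<in> P" "B \<subseteq> A'" using within[OF B(1) Q P] by blast
    have "A \<noteq> {}" using A P by (auto simp: factorization_def indecomposable_def)
    then have "A = A'" using factorization_block_eq[OF P A A'(1)] B(2) A'(2) by blast
    then show "A \<in> Q" using B A' by auto
  qed
  then show ?thesis using assms by blast
qed

text \<open>The partition is carried along the inverse \<open>g\<close> of the relabeling, which
  preserves splitting, indecomposability and types. Factorizations of different representatives can
  thus be compared.\<close>

lemma factorization_sim:
  assumes "((I, a), (J, b)) \<in> sim h" "factorization P I a"
  obtains Q where "factorization Q J b" "block_classes Q J b = block_classes P I a"
proof -
  obtain f where f: "f \<in> bijections J I" "b = Pull h J I f a" and I: "finite I" "a \<in> Ob h I"
    using assms(1) by (rule simE)
  obtain g where g: "g \<in> bijections I J" "\<forall>y\<in>I. f (g y) = y"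
    using I f(1) by (rule bijections_inverse)
  have im: "g ` I = J" and inj: "inj_on g I"
    using g by (auto simp: bijections_def bij_betw_def)
  have P: "pairwise disjnt P" "\<Union>P = I" "\<And>B. B \<in> P \<Longrightarrow> splits I B a"
      "\<And>B. B \<in> P \<Longrightarrow> indecomposable B (restr h I B a)"
    using assms(2) by (auto simp: factorization_def decomposition_def)
  have sub: "B \<subseteq> I" "g ` B \<subseteq> J" and fg: "f ` g ` B = B" if "B \<in> P" for B
    using that P(2) im g(2) by (auto simp: image_image)
  have sim: "((B, restr h I B a), (g ` B, restr h J (g ` B) b)) \<in> sim h" if "B \<in> P" for B
    using sim_restr[OF I f(1) sub(2)[OF that]] fg[OF that] f(2) by simp
  have "g ` B \<inter> g ` D = {}" if "B \<in> P" "D \<in> P" "B \<noteq> D" for B D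
    using P(1) that inj_on_image_Int[OF inj sub(1)[OF that(1)] sub(1)[OF that(2)]]
    by (auto simp: pairwise_def disjnt_def)
  then have "pairwise disjnt ((`) g ` P)"
    unfolding pairwise_def disjnt_def by blast
  moreover have "\<Union>((`) g ` P) = J" using P(2) im by auto
  moreover have "splits J (g ` B) b" if "B \<in> P" for B
    using splits_Pull_iff[OF I f(1) sub(2)[OF that]] P(3)[OF that] fg[OF that] f(2) by simp
  moreover have "indecomposable (g ` B) (restr h J (g ` B) b)" if "B \<in> P" for B
    using indecomposable_sim[OF sim_sym[OF sim[OF that]] P(4)[OF that]] .
  ultimately have "factorization ((`) g ` P) J b"
    by (auto simp: factorization_def decomposition_def)
  moreover have "inj_on ((`) g) P"
    by (rule inj_on_inverseI[of _ "(`) f"]) (rule fg)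
  then have "block_classes ((`) g ` P) J b = block_classes P I a"
    using cls_eqI[OF sim] decomposition_finite[OF I(1)] assms(2)
    by (auto simp: block_classes_def image_mset_mset_set[symmetric] multiset.map_comp comp_def
        factorization_def intro!: image_mset_cong)
  ultimately show thesis using that by blast
qed

section \<open>The induced product and irreducible coinvariants\<close>

lemma coinv_prod_cls:
  assumes "finite I" "a \<in> Ob h I" "finite J" "b \<in> Ob h J" "I \<inter> J = {}"
  shows "coinv_prod h (cls I a) (cls J b) = cls (I \<union> J) (Star h I J a b)"
  unfolding coinv_prod_def
proof (rule the_equality)
  obtain I' a' where I': "(I', a') \<in> std_objects h" "((I, a), (I', a')) \<in> sim h"
    using sim_std_object[OF assms(1,2)] by blast
  obtain K c where K: "(K, c) \<in> std_objects h" "((J, b), (K, c)) \<in> sim h"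
    using sim_std_object[OF assms(3,4)] by blast
  \<comment> \<open>Standard ground sets all start at 1, so nonempty ones overlap; the second
    representative is moved off the first.\<close>
  obtain J' b' where J': "((K, c), (J', b')) \<in> sim h" "I' \<inter> J' = {}"
    using sim_relabel_disjoint[of K c I'] K(1) I'(1) std_objects_closed by metis
  have "((J, b), (J', b')) \<in> sim h" using K(2) J'(1) by (rule sim_trans)
  from cls_eqI[OF sim_Star[OF I'(2) this assms(5) J'(2)]]
  show "\<exists>I' a' y J' b'. (I', a') \<in> cls I a \<and> y \<in> cls J b \<and> (y, (J', b')) \<in> sim h \<and>
      I' \<inter> J' = {} \<and> cls (I \<union> J) (Star h I J a b) = cls (I' \<union> J') (Star h I' J' a' b')"
    using I' K J' unfolding coinv_class_def by blast
next
  fix \<gamma>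
  assume "\<exists>I' a' y J' b'. (I', a') \<in> cls I a \<and> y \<in> cls J b \<and> (y, (J', b')) \<in> sim h \<and>
      I' \<inter> J' = {} \<and> \<gamma> = cls (I' \<union> J') (Star h I' J' a' b')"
  then obtain I' a' K c J' b' where *: "(I', a') \<in> cls I a" "(K, c) \<in> cls J b"
      "((K, c), (J', b')) \<in> sim h" "I' \<inter> J' = {}" "\<gamma> = cls (I' \<union> J') (Star h I' J' a' b')"
    by (metis surj_pair)
  have "((J, b), (J', b')) \<in> sim h"
    using mem_cls(1)[OF assms(3,4) *(2)] *(3) by (rule sim_trans)
  \<comment> \<open>Every admissible choice of representatives is related to the given pair, so
    \<open>sim_Star\<close> leads to the same class.\<close>
  from cls_eqI[OF sim_Star[OF mem_cls(1)[OF assms(1,2) *(1)] this assms(5) *(4)]]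
  show "\<gamma> = cls (I \<union> J) (Star h I J a b)" using *(5) by simp
qed

lemma cls_eq_coinv_unit_iff:
  assumes "finite I" "c \<in> Ob h I"
  shows "cls I c = coinv_unit h \<longleftrightarrow> I = {}"
proof
  assume "cls I c = coinv_unit h"
  then have "((I, c), ({}, Unit h)) \<in> sim h"
    using cls_eq_iff[of I c "{}" "Unit h"] assms Unit_closed by (simp add: coinv_unit_def)
  then show "I = {}" using sim_card assms by fastforce
qed (use assms Ob_empty in \<open>auto simp: coinv_unit_def\<close>)

text \<open>A splitting set writes the class as a product of the classes of its two parts, and a
  factor is the unit exactly when its ground set is empty. Conversely, indecomposability passes to
  any product of disjoint copies representing the class, and there the ground set of the first
  factor is a splitting set.\<close>

lemma irreducible_coinvariants_cls_iff:
  assumes "finite I" "c \<in> Ob h I"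
  shows "cls I c \<in> irreducible_coinvariants h \<longleftrightarrow> indecomposable I c"
proof
  assume irr: "cls I c \<in> irreducible_coinvariants h"
  have "A = {} \<or> A = I" if A: "splits I A c" for A
  proof -
    have sub: "A \<subseteq> I" using A by (simp add: splits_def)
    have fin: "finite A" "finite (I - A)" using sub assms(1) by (auto intro: finite_subset)
    have ob: "restr h I A c \<in> Ob h A" "restr h I (I - A) c \<in> Ob h (I - A)"
      using sub assms by (auto intro: restr_closed)
    have "coinv_prod h (cls A (restr h I A c)) (cls (I - A) (restr h I (I - A) c)) =
        cls (A \<union> (I - A)) (Star h A (I - A) (restr h I A c) (restr h I (I - A) c))"
      using fin ob by (intro coinv_prod_cls) auto
    also have "\<dots> = cls I c" using A sub by (simp add: splits_def Un_absorb1)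
    finally have "cls A (restr h I A c) = coinv_unit h \<or> cls (I - A) (restr h I (I - A) c) = coinv_unit h"
      using irr fin ob unfolding irreducible_coinvariants_def by (auto simp: cls_closed)
    then show ?thesis using fin ob sub by (auto simp: cls_eq_coinv_unit_iff)
  qed
  moreover have "I \<noteq> {}"
    using irr assms by (auto simp: irreducible_coinvariants_def cls_eq_coinv_unit_iff)
  ultimately show "indecomposable I c" by (simp add: indecomposable_def)
next
  assume ind: "indecomposable I c"
  have "\<alpha> = coinv_unit h \<or> \<beta> = coinv_unit h"
    if ab: "\<alpha> \<in> coinvariants h" "\<beta> \<in> coinvariants h" and eq: "cls I c = coinv_prod h \<alpha> \<beta>" for \<alpha> \<beta>
  proof -
    obtain A a where A: "finite A" "a \<in> Ob h A" "\<alpha> = cls A a"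
      using ab(1) by (rule coinvariantsE)
    obtain B0 b0 where B0: "finite B0" "b0 \<in> Ob h B0" "\<beta> = cls B0 b0"
      using ab(2) by (rule coinvariantsE)
    obtain B b where sim: "((B0, b0), (B, b)) \<in> sim h" and disj: "A \<inter> B = {}"
      using B0(1,2) A(1) by (rule sim_relabel_disjoint)
    have B: "finite B" "b \<in> Ob h B" "\<beta> = cls B b"
      using sim cls_eqI[OF sim] B0(3) by (auto elim: simE)
    have "cls I c = cls (A \<union> B) (Star h A B a b)"
      using eq A B disj by (simp add: coinv_prod_cls)
    then have "((A \<union> B, Star h A B a b), (I, c)) \<in> sim h"
      using A B disj assms by (subst cls_eq_iff[symmetric]) (auto intro: Star_closed)
    then have "indecomposable (A \<union> B) (Star h A B a b)" using ind by (rule indecomposable_sim)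
    then have "A = {} \<or> A = A \<union> B"
      using splits_Star[OF A(1) B(1) disj A(2) B(2)] by (simp add: indecomposable_def)
    then have "A = {} \<or> B = {}" using disj by blast
    then show ?thesis using A B by (simp add: cls_eq_coinv_unit_iff)
  qed
  then show "cls I c \<in> irreducible_coinvariants h"
    using ind assms
    by (auto simp: irreducible_coinvariants_def cls_closed cls_eq_coinv_unit_iff indecomposable_def)
qed

section \<open>The multiset of irreducible factors of a coinvariant\<close>

definition factor_classes :: "(nat set \<times> 'a) set \<Rightarrow> (nat set \<times> 'a) set multiset" where
  "factor_classes \<gamma> = (THE m. \<exists>I c P. finite I \<and> c \<in> Ob h I \<and> \<gamma> = cls I c \<and>
     factorization P I c \<and> m = block_classes P I c)"

text \<open>A factorization of another representative is transported to \<open>c\<close> by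
  \<open>factorization_sim\<close> and equals \<open>P\<close> there by uniqueness.\<close>

lemma factor_classes_cls:
  assumes "finite I" "c \<in> Ob h I" "factorization P I c"
  shows "factor_classes (cls I c) = block_classes P I c"
  unfolding factor_classes_def
proof (rule the_equality)
  fix m
  assume "\<exists>J d Q. finite J \<and> d \<in> Ob h J \<and> cls I c = cls J d \<and> factorization Q J d \<and>
      m = block_classes Q J d"
  then obtain J d Q where J: "finite J" "d \<in> Ob h J" "cls I c = cls J d" "factorization Q J d"
      "m = block_classes Q J d" by blast
  then have "((J, d), (I, c)) \<in> sim h" using cls_eq_iff assms by metis
  then obtain Q' where Q': "factorization Q' I c" "block_classes Q' I c = block_classes Q J d"
    using J(4) by (rule factorization_sim)
  then show "m = block_classes P I c"
    using factorization_unique[OF assms(1,2) Q'(1) assms(3)] J(5) by simp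
qed (use assms in blast)

lemma factor_classes_repE:
  assumes "\<gamma> \<in> coinvariants h"
  obtains I c P where "finite I" "c \<in> Ob h I" "\<gamma> = cls I c" "factorization P I c"
    "factor_classes \<gamma> = block_classes P I c"
  using assms factorization_exists factor_classes_cls by (metis coinvariantsE)

lemma set_block_classes:
  assumes "finite I" "c \<in> Ob h I" "factorization P I c"
  shows "set_mset (block_classes P I c) \<subseteq> irreducible_coinvariants h"
proof -
  have P: "finite P" "\<And>B. B \<in> P \<Longrightarrow> B \<subseteq> I \<and> indecomposable B (restr h I B c)"
    using assms decomposition_finite[of I P c] by (auto simp: factorization_def decomposition_def)
  then have "cls B (restr h I B c) \<in> irreducible_coinvariants h" if "B \<in> P" for B
    using that assms(1,2)
    by (subst irreducible_coinvariants_cls_iff) (auto intro: finite_subset restr_closed)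
  then show ?thesis using P(1) by (auto simp: block_classes_def)
qed

text \<open>Multiply the object built so far by a disjoint copy of the next irreducible one, whose
  ground set becomes an additional block.\<close>

lemma exists_factorization_of_classes:
  assumes "set_mset m \<subseteq> irreducible_coinvariants h"
  shows "\<exists>I c P. finite I \<and> c \<in> Ob h I \<and> factorization P I c \<and> block_classes P I c = m"
  using assms
proof (induction m)
  case empty
  show ?case
    by (intro exI[of _ "{}"] exI[of _ "Unit h"])
      (auto simp: Unit_closed factorization_def decomposition_def block_classes_def)
next
  case (add \<iota> m)
  obtain I c P where I: "finite I" "c \<in> Ob h I" "factorization P I c" "block_classes P I c = m"
    using add by auto
  have "\<iota> \<in> coinvariants h" using add.prems by (auto simp: irreducible_coinvariants_def)
  then obtain J0 b0 where J0: "finite J0" "b0 \<in> Ob h J0" "\<iota> = cls J0 b0" by (rule coinvariantsE)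
  obtain J b where sim: "((J0, b0), (J, b)) \<in> sim h" and disj: "I \<inter> J = {}"
    using J0(1,2) I(1) by (rule sim_relabel_disjoint)
  have J: "finite J" "b \<in> Ob h J" "\<iota> = cls J b"
    using sim cls_eqI[OF sim] J0(3) by (auto elim: simE)
  have ind: "indecomposable J b"
    using add.prems J irreducible_coinvariants_cls_iff by auto
  define c' where "c' = Star h I J c b"
  have c': "finite (I \<union> J)" "c' \<in> Ob h (I \<union> J)"
    using I J disj by (auto simp: c'_def intro: Star_closed)
  have res: "restr h (I \<union> J) I c' = c" "restr h (I \<union> J) J c' = b"
    using I J disj by (simp_all add: c'_def Star_restr_left Star_restr_right Ob_empty)
  have spl: "splits (I \<union> J) I c'"
    unfolding c'_def using I J disj by (intro splits_Star) auto
  have "I \<union> J - I = J" using disj by auto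
  then have splJ: "splits (I \<union> J) J c'" using splits_compl[OF c' spl] by simp
  have P: "pairwise disjnt P" "\<Union>P = I" "\<And>B. B \<in> P \<Longrightarrow> splits I B c"
      "\<And>B. B \<in> P \<Longrightarrow> indecomposable B (restr h I B c)"
    using I(3) by (auto simp: factorization_def decomposition_def)
  have fin: "finite P" using P(2) I(1) by (auto intro: finite_UnionD)
  have resB: "restr h (I \<union> J) B c' = restr h I B c" if "B \<in> P" for B
  proof -
    have "B \<subseteq> I" using that P(2) by auto
    then show ?thesis using restr_restr[OF c', of I B] res(1) by simp
  qed
  have "disjnt J B" if "B \<in> P" for B using that P(2) disj by (auto simp: disjnt_def)
  then have "pairwise disjnt (insert J P)"
    using P(1) by (auto simp: pairwise_insert disjnt_sym)
  moreover have "splits (I \<union> J) B c'" if "B \<in> P" for B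
    using splits_trans[OF c' spl] P(3)[OF that] res(1) by simp
  ultimately have "factorization (insert J P) (I \<union> J) c'"
    using P(2,4) splJ res(2) resB ind by (auto simp: factorization_def decomposition_def)
  \<comment> \<open>As \<open>J\<close> is nonempty and disjoint from \<open>I\<close>, it is a new
    block, so the multiset grows by one even if \<open>\<iota>\<close> already occurs in
    \<open>m\<close>.\<close>
  moreover have "J \<notin> P"
    using P(2) disj ind by (auto simp: indecomposable_def)
  then have "block_classes (insert J P) (I \<union> J) c' = add_mset \<iota> m"
    using fin res(2) resB J(3) I(4)
    by (auto simp: block_classes_def intro!: image_mset_cong)
  ultimately show ?case using c' by blast
qed

text \<open>Unique factorization: injectivity is reconstruction from blocks by
  \<open>sim_of_block_classes\<close>, surjectivity is
  \<open>exists_factorization_of_classes\<close>.\<close>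

lemma bij_betw_factor_classes:
  "bij_betw factor_classes (coinvariants h) {m. set_mset m \<subseteq> irreducible_coinvariants h}"
proof (rule bij_betwI')
  fix \<gamma> \<delta> assume "\<gamma> \<in> coinvariants h" "\<delta> \<in> coinvariants h"
  then obtain I c P J d Q where I: "finite I" "c \<in> Ob h I" "\<gamma> = cls I c" "factorization P I c"
      "factor_classes \<gamma> = block_classes P I c"
    and J: "finite J" "d \<in> Ob h J" "\<delta> = cls J d" "factorization Q J d"
      "factor_classes \<delta> = block_classes Q J d"
    by (metis factor_classes_repE)
  show "factor_classes \<gamma> = factor_classes \<delta> \<longleftrightarrow> \<gamma> = \<delta>"
    using sim_of_block_classes[of I c P J d Q] I J cls_eqI by (auto simp: factorization_def)
next
  fix \<gamma> assume "\<gamma> \<in> coinvariants h"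
  then obtain I c P where "finite I" "c \<in> Ob h I" "factorization P I c"
      "factor_classes \<gamma> = block_classes P I c"
    by (rule factor_classes_repE)
  then show "factor_classes \<gamma> \<in> {m. set_mset m \<subseteq> irreducible_coinvariants h}"
    using set_block_classes by simp
next
  fix m assume "m \<in> {m. set_mset m \<subseteq> irreducible_coinvariants h}"
  then obtain I c P where "finite I" "c \<in> Ob h I" "factorization P I c" "block_classes P I c = m"
    using exists_factorization_of_classes by blast
  then show "\<exists>\<gamma>\<in>coinvariants h. m = factor_classes \<gamma>"
    using factor_classes_cls cls_closed by metis
qed

text \<open>Indecomposable sets covering \<open>I\<close> lie in single blocks, so there are at least as many of
  them as there are blocks, with equality only if they are the blocks.\<close>

lemma covers_irreducible:
  assumes I: "finite I" "c \<in> Ob h I" and P: "factorization P I c"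
    and As: "As \<in> covers ls I c" and ls: "set ls \<subseteq> irreducible_coinvariants h"
  shows "block_classes P I c = mset ls \<or> size (block_classes P I c) < size (mset ls)"
proof -
  have U: "\<Union>(set As) = I" and map: "map (\<lambda>A. cls A (restr h I A c)) As = ls"
    using As by (auto simp: covers_def)
  have PU: "\<Union>P = I" and ne: "\<And>B. B \<in> P \<Longrightarrow> B \<noteq> {}"
    using P by (auto simp: factorization_def decomposition_def indecomposable_def)
  have fin: "finite P" using PU I(1) by (auto intro: finite_UnionD)
  have within: "\<exists>B\<in>P. A \<subseteq> B" if A: "A \<in> set As" for A
  proof -
    have sub: "A \<subseteq> I" using A U by auto
    have "cls A (restr h I A c) \<in> irreducible_coinvariants h" using A map ls by auto
    then have "indecomposable A (restr h I A c)"
      using irreducible_coinvariants_cls_iff[of A "restr h I A c"] sub I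
      by (auto intro: finite_subset restr_closed)
    then show ?thesis by (rule indecomposable_within_block[OF I P sub]) blast
  qed
  then obtain f where f: "\<And>A. A \<in> set As \<Longrightarrow> f A \<in> P \<and> A \<subseteq> f A" by metis
  have hit: "\<exists>A\<in>set As. x \<in> A \<and> f A = B" if B: "B \<in> P" "x \<in> B" for B x
  proof -
    have "x \<in> \<Union>(set As)" using B PU U by auto
    then obtain A where A: "A \<in> set As" "x \<in> A" by auto
    then have "f A = B" using factorization_block_eq[OF P _ B(1)] f[OF A(1)] B(2) by blast
    then show ?thesis using A by blast
  qed
  \<comment> \<open>Blocks are nonempty, and a point of a block is covered only by entries that
    \<open>f\<close> sends to that block.\<close>
  have im: "f ` set As = P"
  proof
    show "P \<subseteq> f ` set As" using hit ne by blast
  qed (use f in auto)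
  have size: "size (block_classes P I c) = card P" "length ls = length As"
    using map by (auto simp: block_classes_def)
  have le: "card P \<le> card (set As)" "card (set As) \<le> length As"
    using im card_image_le[of "set As" f] card_length[of As] by auto
  show ?thesis
  proof (cases "card P < length As")
    case False
    then have card: "card P = card (set As)" "card (set As) = length As" using le by auto
    then have dist: "distinct As" and inj: "inj_on f (set As)"
      using im by (auto simp: card_distinct intro: eq_card_imp_inj_on)
    \<comment> \<open>In the equality case \<open>f\<close> is injective on the entries. A point of
      \<open>f A\<close> lies in an entry with the same image, which must be
      \<open>A\<close>.\<close>
    have "f A = A" if A: "A \<in> set As" for A
    proof
      show "f A \<subseteq> A"
      proof
        fix x assume "x \<in> f A"
        then obtain A' where "A' \<in> set As" "x \<in> A'" "f A' = f A" using hit f[OF A] by blast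
        then show "x \<in> A" using inj A by (auto dest: inj_onD)
      qed
    qed (use f A in blast)
    then have "set As = P" using im by simp
    then have "mset_set P = mset As" using dist mset_set_set by blast
    then show ?thesis using map by (auto simp: block_classes_def)
  qed (simp add: size)
qed

text \<open>The blocks themselves, ordered to match \<open>ls\<close>, form a cover. This makes the
  diagonal coefficients nonzero.\<close>

lemma covers_block_classes:
  assumes "finite I" "factorization P I c" "block_classes P I c = mset ls"
  shows "covers ls I c \<noteq> {}"
proof -
  have PU: "\<Union>P = I" using assms(2) by (auto simp: factorization_def decomposition_def)
  then have "finite P" using assms(1) by (auto intro: finite_UnionD)
  obtain As where As: "mset As = mset_set P" "map (\<lambda>B. cls B (restr h I B c)) As = ls"
    using assms(3) unfolding block_classes_def by (rule image_mset_eq_mset_map)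
  have "set As = P" using arg_cong[OF As(1), of set_mset] \<open>finite P\<close> by simp
  then have "As \<in> covers ls I c" using As(2) PU by (simp add: covers_def)
  then show ?thesis by blast
qed

section \<open>Triangularity of the monomials over the pattern functions\<close>

lemma irreducible_coinvariants_subset: "irreducible_coinvariants h \<subseteq> coinvariants h"
  by (auto simp: irreducible_coinvariants_def)

text \<open>The rank is the number of irreducible factors with multiplicity. Rows come from
  \<open>prod_pattern_fun\<close> on the chosen ordering, triangularity from
  \<open>covers_irreducible\<close> and the diagonal from
  \<open>covers_block_classes\<close>.\<close>

lemma triangular_family_pattern_fun:
  "triangular_family (coinvariants h) (coinvariants h)
     {m. set_mset m \<subseteq> irreducible_coinvariants h} (pattern_fun h)
     (\<lambda>m \<beta>. \<Prod>\<iota>\<in>#m. pattern_fun h \<iota> \<beta>) factor_classes (\<lambda>m. cover_support (some_list m))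
     (\<lambda>m \<gamma>. of_nat (cover_count (some_list m) \<gamma>)) size"
proof
  show "bij_betw factor_classes (coinvariants h) {m. set_mset m \<subseteq> irreducible_coinvariants h}"
    by (rule bij_betw_factor_classes)
next
  fix m \<beta>
  assume m: "m \<in> {m. set_mset m \<subseteq> irreducible_coinvariants h}" and \<beta>: "\<beta> \<in> coinvariants h"
  have "set (some_list m) \<subseteq> coinvariants h"
    using m irreducible_coinvariants_subset by (metis mem_Collect_eq mset_some_list set_mset_mset subset_trans)
  moreover have "(\<Prod>\<iota>\<in>#m. pattern_fun h \<iota> \<beta>) = (\<Prod>\<iota>\<leftarrow>some_list m. pattern_fun h \<iota> \<beta>)"
    by (metis mset_map mset_some_list prod_mset_prod_list)
  ultimately show "(\<Prod>\<iota>\<in>#m. pattern_fun h \<iota> \<beta>) = (\<Sum>\<gamma>\<in>cover_support (some_list m).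
      of_nat (cover_count (some_list m) \<gamma>) * pattern_fun h \<gamma> \<beta>)"
    using prod_pattern_fun \<beta> by simp
next
  fix m :: "(nat set \<times> 'a) set multiset"
  show "finite (cover_support (some_list m))" by (rule finite_cover_support)
  show "cover_support (some_list m) \<subseteq> coinvariants h" by (auto simp: cover_support_def)
next
  fix m \<gamma>
  assume m: "m \<in> {m. set_mset m \<subseteq> irreducible_coinvariants h}"
    and \<gamma>: "\<gamma> \<in> cover_support (some_list m)"
  obtain I c P where I: "finite I" "c \<in> Ob h I" "\<gamma> = cls I c" "factorization P I c"
      "factor_classes \<gamma> = block_classes P I c"
    using \<gamma> by (auto simp: cover_support_def elim: factor_classes_repE)
  then have "covers (some_list m) I c \<noteq> {}"
    using \<gamma> by (auto simp: cover_support_def cover_count_cls)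
  moreover have "set (some_list m) \<subseteq> irreducible_coinvariants h"
    using m by (metis mem_Collect_eq mset_some_list set_mset_mset)
  ultimately show "factor_classes \<gamma> = m \<or> size (factor_classes \<gamma>) < size m"
    using covers_irreducible[OF I(1,2,4), of _ "some_list m"] I(5) by auto
next
  fix \<gamma> assume \<gamma>: "\<gamma> \<in> coinvariants h"
  then obtain I c P where I: "finite I" "c \<in> Ob h I" "\<gamma> = cls I c" "factorization P I c"
      "factor_classes \<gamma> = block_classes P I c"
    by (rule factor_classes_repE)
  then have "covers (some_list (factor_classes \<gamma>)) I c \<noteq> {}"
    by (intro covers_block_classes) simp_all
  then have "cover_count (some_list (factor_classes \<gamma>)) \<gamma> \<noteq> 0"
    using I finite_covers by (simp add: cover_count_cls)
  then show "\<gamma> \<in> cover_support (some_list (factor_classes \<gamma>)) \<and>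
      (of_nat (cover_count (some_list (factor_classes \<gamma>)) \<gamma>) :: rat) \<noteq> 0"
    using \<gamma> by (simp add: cover_support_def)
qed

text \<open>If the functions agree, each coinvariant occurs in the other, which
  \<open>pattern_fun_eq_0\<close> rules out for distinct ones after comparing sizes. The generators
  are thus indexed without repetition.\<close>

lemma inj_on_pattern_fun: "inj_on (pattern_fun h) (coinvariants h)"
proof (rule inj_onI)
  fix \<alpha> \<beta> assume ab: "\<alpha> \<in> coinvariants h" "\<beta> \<in> coinvariants h" and eq: "pattern_fun h \<alpha> = pattern_fun h \<beta>"
  have "pattern_fun h \<alpha> \<beta> = 1" "pattern_fun h \<beta> \<alpha> = 1"
    using pattern_fun_self ab eq by metis+
  then show "\<alpha> = \<beta>"
    using pattern_fun_eq_0[OF ab] pattern_fun_eq_0[OF ab(2,1)] by (metis linear zero_neq_one)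
qed

end

section \<open>Freeness of the pattern algebra\<close>

theorem mainTheorem10:
  fixes h :: "('a, 'm) monoid_presheaf_scheme"
  assumes "commutative_presheaf h" and "connected_presheaf h"
  shows "free_commutative_algebra rat_field (pattern_algebra h) \<and>
    inj_on (pattern_fun h) (irreducible_coinvariants h) \<and>
    free_generators rat_field (pattern_algebra h) (pattern_fun h ` irreducible_coinvariants h)"
proof -
  interpret connected_commutative_presheaf h
    using assms by (simp add: connected_commutative_presheaf_def connected_commutative_presheaf_axioms_def)
  interpret T: triangular_family "coinvariants h" "coinvariants h"
    "{m. set_mset m \<subseteq> irreducible_coinvariants h}" "pattern_fun h"
    "\<lambda>m \<beta>. \<Prod>\<iota>\<in>#m. pattern_fun h \<iota> \<beta>" factor_classes "\<lambda>m. cover_support (some_list m)"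
    "\<lambda>m \<gamma>. of_nat (cover_count (some_list m) \<gamma>)" size
    by (rule triangular_family_pattern_fun)
  have inj: "inj_on (pattern_fun h) (irreducible_coinvariants h)"
    using inj_on_pattern_fun irreducible_coinvariants_subset by (rule inj_on_subset)
  have "free_generators rat_field (pattern_algebra h) (pattern_fun h ` irreducible_coinvariants h)"
  proof (rule free_generators_function_algebra[OF pattern_algebra_eq algebra_pattern_algebra _ inj])
    show "pattern_carrier \<subseteq> coinvariants h \<rightarrow>\<^sub>E UNIV" by blast
    show "pattern_fun h ` irreducible_coinvariants h \<subseteq> pattern_carrier"
    proof
      fix f assume "f \<in> pattern_fun h ` irreducible_coinvariants h"
      then obtain \<iota> where \<iota>: "\<iota> \<in> coinvariants h" "f = pattern_fun h \<iota>"
        using irreducible_coinvariants_subset by blast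
      then show "f \<in> pattern_carrier"
        using lincomb_on_base[of \<iota> "coinvariants h" "coinvariants h" "pattern_fun h"]
        by (simp add: pattern_fun_def)
    qed
    \<comment> \<open>Every element is a combination of pattern functions, each of which is a
      combination of monomials by \<open>T.lincomb_on_expand\<close>.\<close>
    show "lincomb_on (coinvariants h) {m. set_mset m \<subseteq> irreducible_coinvariants h}
        (\<lambda>m \<beta>. \<Prod>\<iota>\<in>#m. pattern_fun h \<iota> \<beta>) f" if "f \<in> pattern_carrier" for f
      using that T.lincomb_on_expand by (blast intro: lincomb_on_trans)
    show "independent_on (coinvariants h) {m. set_mset m \<subseteq> irreducible_coinvariants h}
        (\<lambda>m \<beta>. \<Prod>\<iota>\<in>#m. pattern_fun h \<iota> \<beta>)"
      using independent_on_pattern_fun by (rule T.independent_on_triangular)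
  qed
  then show ?thesis
    using inj algebra_pattern_algebra unfolding free_commutative_algebra_def by blast
qed

end
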